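(* Let $m,n\ge 1$ be integers. Let $A$ be a random real $m\times(m+n)$ matrix and $b$ a random vector in $\mathbb{R}^m$, such that the random variables $A_{i\alpha}$ and $b_i$ ($i=1,\dots,m$; $\alpha=1,\dots,m+n$) have joint probability density $$G(A,b)=f(\mathrm{tr}\,A^TA+b^Tb)$$ with respect to Lebesgue measure, where $f:(0,\infty)\to[0,\infty)$ is any measurable function satisfying $$\int_0^\infty u^{\frac{m(m+n+1)}{2}-1}f(u)\,du=\frac{2}{S_{m(m+n+1)}}.$$ Write $A=(B,X)$ with $B$ the $m\times m$ matrix of the first $m$ columns of $A$ and $X$ the $m\times n$ matrix of the remaining columns. Fix a parameter vector $u\in\mathbb{R}^n$ and let $z=(z_1,\dots,z_m)^T$ be the solution of the random linear system $Bz=b-Xu$. Then the random variables $z_i$ ($i=1,\dots,m$) are distributed with the universal joint probability density $$P(z;u)=C\,\frac{\beta}{(\beta^2+z^Tz)^{\frac{m+1}{2}}},$$ independently of the function $f$, where $$\beta=\sqrt{1+u^Tu}$$ and $C$ is a normalization constant given by $$C=\int dA\,|\det B|\,f(\mathrm{tr}\,A^TA),$$ the integral being over all real $m\times(m+n)$ matrices $A=(B,X)$.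
   Context: $S_d=\frac{2\pi^{d/2}}{\Gamma(d/2)}$ denotes the surface area of the unit sphere embedded in $d$ dimensions. $dA=\prod_{i,\alpha}dA_{i\alpha}$ is the Cartesian (Lebesgue) measure. The system $Bz=b-Xu$ is the system $\sum_{\alpha=1}^{m+n}A_{i\alpha}\xi_\alpha=b_i$ ($i=1,\dots,m$), where $\xi=(z_1,\dots,z_m,u_1,\dots,u_n)^T$, with the first $m$ components of $\xi$ treated as unknowns and the last $n$ as given parameters. The integral condition on $f$ is equivalent to $\int G(A,b)\,dA\,db=1$. "Independently of $f$" means that the same density, with the same constant $C$, is obtained for every admissible $f$. *)

theory Defs
  imports "HOL-Probability.Probability"
begin

text \<open>A real \<open>m \<times> (m + n)\<close> matrix has type \<^typ>\<open>real ^ ('m + 'n) ^ 'm\<close>. Its columns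
  are indexed by the disjoint sum of \<open>'m\<close> (the first \<open>m\<close> columns) and \<open>'n\<close> (the remaining \<open>n\<close>
  columns), so that \<open>A = (left_block A, right_block A)\<close>.\<close>

definition left_block :: "real ^ ('m::finite + 'n::finite) ^ 'm \<Rightarrow> real ^ 'm ^ 'm" where
  "left_block A = (\<chi> i j. A $ i $ Inl j)"

definition right_block :: "real ^ ('m::finite + 'n::finite) ^ 'm \<Rightarrow> real ^ 'n ^ 'm" where
  "right_block A = (\<chi> i j. A $ i $ Inr j)"

definition sphere_area :: "nat \<Rightarrow> real" where
  "sphere_area d = 2 * pi powr (real d / 2) / Gamma (real d / 2)"

text \<open>Only the values of \<open>f\<close> on \<open>(0, \<infinity>)\<close> are constrained, and only they matter: \<open>f\<close> is
  evaluated at \<open>0\<close> in the densities below only at the origin, a null set.\<close>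

definition admissible :: "nat \<Rightarrow> (real \<Rightarrow> real) \<Rightarrow> bool" where
  "admissible N f \<longleftrightarrow>
     f \<in> borel_measurable (restrict_space borel {0<..}) \<and>
     (\<forall>s>0. f s \<ge> 0) \<and>
     (\<integral>\<^sup>+ s\<in>{0<..}. ennreal (s powr (real N / 2 - 1) * f s) \<partial>lborel) = ennreal (2 / sphere_area N)"

text \<open>The type arguments carry the dimensions \<open>m\<close> and \<open>n\<close>, which \<open>f\<close> alone does not determine.\<close>

definition norm_const :: "'m::finite itself \<Rightarrow> 'n::finite itself \<Rightarrow> (real \<Rightarrow> real) \<Rightarrow> real" where
  "norm_const _ _ f =
     (LINT A|(lborel :: (real ^ ('m + 'n) ^ 'm) measure).
        \<bar>det (left_block A)\<bar> * f (trace (transpose A ** A)))"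

end

theory Submission
  imports Defs
begin

text \<open>Write \<open>A = (B, X)\<close> and let \<open>\<beta> = sqrt (1 + u \<bullet> u)\<close>. For almost every \<open>A\<close> the block \<open>B\<close> is invertible,
  and the substitution \<open>b = B z + X u\<close>, with Jacobian \<open>\<bar>det B\<bar>\<close>, shows that the solution \<open>z\<close> has the density
  \<open>H z = \<integral> \<bar>det B\<bar> * f (\<bar>B\<bar>\<^sup>2 + \<bar>X\<bar>\<^sup>2 + \<bar>B z + X u\<bar>\<^sup>2) dA\<close>
  (\<open>nn_integral_solution\<close>). Everything else is linear algebra inside \<open>f\<close>.

  Completing the square in \<open>X\<close> decouples it from \<open>B\<close>: up to the factor \<open>\<beta>\<close> to the power \<open>- m\<close>, the term
  \<open>\<bar>B z + X u\<bar>\<^sup>2\<close> may be replaced by \<open>\<bar>B z\<bar>\<^sup>2 / \<beta>\<^sup>2\<close> (\<open>nn_integral_complete_square\<close>). Then \<open>B\<close> is stretched in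
  the single direction \<open>z\<close>; undoing the stretch by \<open>\<gamma> = sqrt (1 + z \<bullet> z / \<beta>\<^sup>2)\<close> costs \<open>\<gamma>\<close> to the power \<open>m + 1\<close>,
  one of the factors coming from \<open>\<bar>det B\<bar>\<close> (\<open>nn_integral_det_stretch\<close>). What remains is the integral
  \<open>C = \<integral> \<bar>det B\<bar> * f (\<bar>A\<bar>\<^sup>2) dA\<close>, and the factors combine to \<open>\<beta> / (\<beta>\<^sup>2 + z \<bullet> z) powr ((m + 1) / 2)\<close>
  (\<open>nn_integral_universal_density\<close>). In both steps a rotation first moves \<open>u\<close> or \<open>z\<close> onto a coordinate
  axis, so that only one column of the matrix has to be substituted.

  The constant \<open>C\<close> is universal because \<open>\<bar>det B\<bar>\<close> is homogeneous of degree \<open>m\<close>: in polar coordinates the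
  radial part of the integral is exactly the one that admissibility fixes
  (\<open>nn_integral_homogeneous_radial\<close>, \<open>ennreal_norm_const\<close>).

  Isometries and shears are treated through the translation invariance of Lebesgue measure, which
  determines it up to a factor. That argument works on every Euclidean space, in particular on spaces
  of matrices; scalings of coordinates supply the remaining Jacobians.\<close>

section \<open>Lebesgue measure under linear maps\<close>

lemma nn_integral_lborel_affine:
  fixes h :: "'a::euclidean_space \<Rightarrow> ennreal"
  assumes [measurable]: "h \<in> borel_measurable borel" and "c \<noteq> 0"
  shows "(\<integral>\<^sup>+x. h x \<partial>lborel) = ennreal (\<bar>c\<bar> ^ DIM('a)) * (\<integral>\<^sup>+x. h (t + c *\<^sub>R x) \<partial>lborel)"
  by (subst lborel_affine[OF \<open>c \<noteq> 0\<close>, of t])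
     (simp add: nn_integral_density nn_integral_distr nn_integral_cmult)

lemma nn_integral_lborel_translate:
  fixes h :: "'a::euclidean_space \<Rightarrow> ennreal"
  assumes "h \<in> borel_measurable borel"
  shows "(\<integral>\<^sup>+x. h (t + x) \<partial>lborel) = (\<integral>\<^sup>+x. h x \<partial>lborel)"
  using nn_integral_lborel_affine[OF assms, of 1 t] by simp

lemma nn_integral_lborel_reflect:
  fixes h :: "'a::euclidean_space \<Rightarrow> ennreal"
  assumes "h \<in> borel_measurable borel"
  shows "(\<integral>\<^sup>+x. h (t - x) \<partial>lborel) = (\<integral>\<^sup>+x. h x \<partial>lborel)"
  using nn_integral_lborel_affine[OF assms, of "-1" t] by simp

lemma borel_measurable_linear:
  fixes T :: "'a::euclidean_space \<Rightarrow> 'b::euclidean_space"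
  assumes "linear T" shows "T \<in> borel_measurable borel"
  using assms by (intro borel_measurable_continuous_onI linear_continuous_on linear_conv_bounded_linear[THEN iffD1])

text \<open>The pushforward of Lebesgue measure under a surjective linear map \<open>T\<close> is translation invariant, and
  two translation invariant measures are proportional. The proportionality is stated without
  choosing a constant: integrate \<open>h (T x) * g (T x + y)\<close> over \<open>x\<close> and \<open>y\<close>, once with the \<open>y\<close>-shift
  absorbed in \<open>y\<close>, once with it absorbed in \<open>x\<close>. All measures in the double integral are Lebesgue
  measures, so Fubini applies although the pushforward itself need not be \<open>\<sigma>\<close>-finite.\<close>

lemma nn_integral_linear_exchange:
  fixes T :: "'a::euclidean_space \<Rightarrow> 'b::euclidean_space"
  assumes T: "linear T" "surj T"
    and [measurable]: "g \<in> borel_measurable borel" "h \<in> borel_measurable borel"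
  shows "(\<integral>\<^sup>+x. h (T x) \<partial>lborel) * (\<integral>\<^sup>+y. g y \<partial>lborel) = (\<integral>\<^sup>+x. g (T x) \<partial>lborel) * (\<integral>\<^sup>+y. h y \<partial>lborel)"
proof -
  note [measurable] = borel_measurable_linear[OF T(1)]
  have "(\<integral>\<^sup>+x. h (T x) \<partial>lborel) * (\<integral>\<^sup>+y. g y \<partial>lborel)
      = (\<integral>\<^sup>+x. \<integral>\<^sup>+y. h (T x) * g (T x + y) \<partial>lborel \<partial>lborel)"
    by (simp add: nn_integral_cmult nn_integral_multc nn_integral_lborel_translate)
  also have "\<dots> = (\<integral>\<^sup>+y. \<integral>\<^sup>+x. h (T x) * g (T x + y) \<partial>lborel \<partial>lborel)"
    by (rule lborel_pair.Fubini'[symmetric]) measurable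
  also have "\<dots> = (\<integral>\<^sup>+y. \<integral>\<^sup>+x. h (T x - y) * g (T x) \<partial>lborel \<partial>lborel)"
  proof (rule nn_integral_cong)
    fix y :: 'b
    obtain w where w: "y = T w" using T(2) by (metis surj_def)
    show "(\<integral>\<^sup>+x. h (T x) * g (T x + y) \<partial>lborel) = (\<integral>\<^sup>+x. h (T x - y) * g (T x) \<partial>lborel)"
      using nn_integral_lborel_translate[of "\<lambda>x. h (T x) * g (T x + y)" "- w"]
      by (simp add: w linear_diff[OF T(1)])
  qed
  also have "\<dots> = (\<integral>\<^sup>+x. \<integral>\<^sup>+y. h (T x - y) * g (T x) \<partial>lborel \<partial>lborel)"
    by (rule lborel_pair.Fubini') measurable
  also have "\<dots> = (\<integral>\<^sup>+x. g (T x) \<partial>lborel) * (\<integral>\<^sup>+y. h y \<partial>lborel)"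
    by (simp add: nn_integral_multc nn_integral_cmult nn_integral_lborel_reflect) (rule mult.commute)
  finally show ?thesis .
qed

text \<open>A norm preserving map takes the unit ball to the unit ball, and the volume of a ball depends only
  on the dimension; the factor of proportionality is therefore \<open>1\<close>. The two spaces may differ, which
  lets a block matrix be exchanged for the pair of its blocks.\<close>

lemma nn_integral_linear_isometry:
  fixes T :: "'a::euclidean_space \<Rightarrow> 'b::euclidean_space"
  assumes T: "linear T" "\<And>x. norm (T x) = norm x" and dim: "DIM('a) = DIM('b)"
    and [measurable]: "h \<in> borel_measurable borel"
  shows "(\<integral>\<^sup>+x. h (T x) \<partial>lborel) = (\<integral>\<^sup>+y. h y \<partial>lborel)"
proof -
  have "inj T"
    by (rule linear_injective_0[OF T(1), THEN iffD2]) (metis T(2) norm_eq_zero)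
  then have "surj T"
    using dim_image_eq[OF T(1), of UNIV] dim dim_eq_full[of "range T"]
    by (simp add: linear_span_image[OF T(1)])
  let ?b = "\<lambda>y. indicator (ball 0 1) y :: ennreal"
  have "(\<integral>\<^sup>+x. ?b (T x) \<partial>lborel) = (\<integral>\<^sup>+x. indicator (ball 0 1) x \<partial>(lborel::'a measure))"
    by (intro nn_integral_cong) (auto simp: indicator_def T(2))
  also have "\<dots> = emeasure lborel (ball 0 1 :: 'a set)"
    by simp
  also have "\<dots> = emeasure lborel (ball 0 1 :: 'b set)"
    by (simp add: emeasure_ball dim)
  finally have eq: "(\<integral>\<^sup>+x. ?b (T x) \<partial>lborel) = emeasure lborel (ball 0 1 :: 'b set)" .
  have "emeasure lborel (ball 0 1 :: 'b set) * (\<integral>\<^sup>+x. h (T x) \<partial>lborel) = emeasure lborel (ball 0 1 :: 'b set) * (\<integral>\<^sup>+y. h y \<partial>lborel)"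
    using nn_integral_linear_exchange[OF T(1) \<open>surj T\<close>, of ?b h] eq
    by (simp add: mult.commute borel_measurable_indicator)
  then show ?thesis
    using unit_ball_vol_pos[of "real DIM('b)", THEN less_imp_neq] by (simp add: ennreal_mult_cancel_left emeasure_ball)
qed

text \<open>For a bijection the preimage of the unit ball is open and bounded, so the factor of
  proportionality is positive and finite.\<close>

lemma nn_integral_linear_scaling:
  fixes T :: "'a::euclidean_space \<Rightarrow> 'b::euclidean_space"
  assumes T: "linear T" "inj T" "surj T"
  obtains k :: real where "k > 0"
    "\<And>h. h \<in> borel_measurable borel \<Longrightarrow> (\<integral>\<^sup>+y. h y \<partial>lborel) = ennreal k * (\<integral>\<^sup>+x. h (T x) \<partial>lborel)"
proof -
  note [measurable] = borel_measurable_linear[OF T(1)]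
  let ?V = "T -` ball 0 1 :: 'a set"
  have [measurable]: "?V \<in> sets borel"
    using measurable_sets_borel[OF borel_measurable_linear[OF T(1)], of "ball 0 1"] by simp
  have "open ?V"
    using T(1) by (intro open_vimage linear_continuous_on linear_conv_bounded_linear[THEN iffD1]) auto
  moreover have "0 \<in> ?V" by (simp add: linear_0[OF T(1)])
  ultimately obtain e where e: "e > 0" "ball 0 e \<subseteq> ?V"
    by (meson open_contains_ball)
  have "0 < emeasure lborel (ball 0 e :: 'a set)"
    using e by (simp add: emeasure_ball)
  also have "\<dots> \<le> emeasure lborel ?V"
    by (intro emeasure_mono e) auto
  finally have pos: "0 < emeasure lborel ?V" .
  obtain B where B: "B > 0" "\<And>x. norm (T x) \<ge> B * norm x"
    using linear_inj_bounded_below_pos[OF T(1,2)] by (metis mult.commute)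
  have "?V \<subseteq> ball 0 (1 / B)"
    using B by (auto simp: field_simps) (meson le_less_trans)
  then have "emeasure lborel ?V \<le> emeasure lborel (ball 0 (1 / B) :: 'a set)"
    by (intro emeasure_mono) auto
  then have "emeasure lborel ?V < \<infinity>"
    using B by (auto simp: emeasure_ball less_top[symmetric] top_unique)
  then obtain a where a: "emeasure lborel ?V = ennreal a" "a > 0"
    using pos by (metis ennreal_cases ennreal_eq_0_iff infinity_ennreal_def less_irrefl not_le)
  define b where "b = measure lborel (ball 0 1 :: 'b set)"
  have b: "emeasure lborel (ball 0 1 :: 'b set) = ennreal b" "b > 0"
    by (auto simp: b_def content_ball emeasure_ball)
  show thesis
  proof (rule that[of "b / a"])
    fix h :: "'b \<Rightarrow> ennreal" assume [measurable]: "h \<in> borel_measurable borel"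
    have "(\<integral>\<^sup>+x. indicator (ball 0 1) (T x) \<partial>lborel) = (\<integral>\<^sup>+x. indicator ?V x \<partial>(lborel :: 'a measure))"
      by (intro nn_integral_cong) (simp add: indicator_def)
    also have "\<dots> = ennreal a" using a by simp
    finally have eq: "(\<integral>\<^sup>+x. h (T x) \<partial>lborel) * ennreal b = ennreal a * (\<integral>\<^sup>+y. h y \<partial>lborel)"
      using nn_integral_linear_exchange[OF T(1,3), of "indicator (ball 0 1)" h] b
      by (simp add: borel_measurable_indicator)
    have "ennreal (b / a) * (\<integral>\<^sup>+x. h (T x) \<partial>lborel) = ennreal (1 / a) * (ennreal b * (\<integral>\<^sup>+x. h (T x) \<partial>lborel))"
      using a b by (simp add: mult.assoc[symmetric] ennreal_mult'[symmetric])
    also have "\<dots> = (\<integral>\<^sup>+y. h y \<partial>lborel)"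
      using a eq by (simp add: mult.assoc[symmetric] mult.commute[of "ennreal b"] ennreal_mult'[symmetric])
    finally show "(\<integral>\<^sup>+y. h y \<partial>lborel) = ennreal (b / a) * (\<integral>\<^sup>+x. h (T x) \<partial>lborel)" ..
  qed (use a b in auto)
qed

section \<open>Jacobians of column operations and of matrices\<close>

lemma Basis_matrix_prod:
  fixes c :: real and e :: "'k::finite"
  shows "(\<Prod>b\<in>(Basis :: (real^'k^'m::finite) set). if \<exists>i. b = axis i (axis e 1) then c else 1) = c ^ CARD('m)"
proof -
  have "(\<Prod>b\<in>(Basis :: (real^'k^'m) set). if \<exists>i. b = axis i (axis e 1) then c else 1)
     = (\<Prod>b\<in>(\<lambda>i. axis i (axis e 1) :: real^'k^'m) ` UNIV. c)"
    by (rule prod.mono_neutral_cong_right) (auto simp: Basis_vec_def)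
  also have "\<dots> = c ^ CARD('m)"
    by (subst prod.reindex) (auto simp: inj_on_def axis_eq_axis)
  finally show ?thesis .
qed

text \<open>The column \<open>e\<close> of an \<open>m\<close>-row matrix consists of \<open>m\<close> coordinates, hence the power \<open>m\<close> of \<open>c\<close>.\<close>

lemma nn_integral_column_affine:
  fixes h :: "real^'k::finite^'m::finite \<Rightarrow> ennreal"
  assumes [measurable]: "h \<in> borel_measurable borel" and c: "c \<noteq> 0"
  shows "(\<integral>\<^sup>+X. h X \<partial>lborel)
    = ennreal (\<bar>c\<bar> ^ CARD('m)) * (\<integral>\<^sup>+X. h (\<chi> i j. if j = e then s $ i + c * X $ i $ j else X $ i $ j) \<partial>lborel)"
proof -
  define cf :: "real^'k^'m \<Rightarrow> real" where "cf b = (if \<exists>i. b = axis i (axis e 1) then c else 1)" for b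
  define t :: "real^'k^'m" where "t = (\<chi> i j. if j = e then s $ i else 0)"
  define T where "T X = t + (\<Sum>b\<in>Basis. (cf b * (X \<bullet> b)) *\<^sub>R b)" for X
  have [measurable]: "T \<in> borel_measurable borel"
    unfolding T_def by measurable
  have cf0: "cf b \<noteq> 0" for b using c by (simp add: cf_def)
  have "T X $ i $ j = (if j = e then s $ i + c * X $ i $ j else X $ i $ j)" for X i j
  proof -
    have ij: "axis i (axis j 1) \<in> (Basis :: (real^'k^'m) set)"
      by (auto simp: Basis_vec_def)
    have entry: "Y $ i $ j = Y \<bullet> axis i (axis j 1)" for Y :: "real^'k^'m"
      by (simp add: inner_axis)
    have "T X $ i $ j = t $ i $ j + cf (axis i (axis j 1)) * X $ i $ j"
      unfolding entry using ij by (simp add: T_def inner_add_left inner_sum_left_Basis)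
    then show ?thesis by (auto simp: t_def cf_def axis_eq_axis)
  qed
  then have T: "T = (\<lambda>X. \<chi> i j. if j = e then s $ i + c * X $ i $ j else X $ i $ j)"
    by (auto simp: fun_eq_iff vec_eq_iff)
  have prod: "(\<Prod>b\<in>Basis. \<bar>cf b\<bar>) = \<bar>c\<bar> ^ CARD('m)"
    unfolding Basis_matrix_prod[symmetric, of "\<bar>c\<bar>" e] by (rule prod.cong) (auto simp: cf_def)
  have "(\<integral>\<^sup>+X. h X \<partial>lborel) = ennreal (\<Prod>b\<in>Basis. \<bar>cf b\<bar>) * (\<integral>\<^sup>+X. h (T X) \<partial>lborel)"
    by (subst lborel_affine_euclidean[where c=cf and t=t, OF cf0])
       (simp add: nn_integral_density nn_integral_distr nn_integral_cmult flip: T_def)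
  then show ?thesis by (simp add: prod T)
qed

text \<open>The Jacobian of a linear map, by factoring the matrix into elementary ones. Transpositions are
  isometries and diagonal matrices scale coordinates. A shear \<open>S\<close> is inverted by conjugation with the
  reflection \<open>D\<close> of one coordinate; since \<open>D\<close> is an isometry, the scaling factor \<open>k\<close> of \<open>S\<close> satisfies
  \<open>k * k = 1\<close>.\<close>

lemma nn_integral_matrix_vector_mult:
  fixes B :: "real^'n::finite^'n" and h :: "real^'n \<Rightarrow> ennreal"
  assumes "det B \<noteq> 0" and "h \<in> borel_measurable borel"
  shows "(\<integral>\<^sup>+x. h x \<partial>lborel) = ennreal \<bar>det B\<bar> * (\<integral>\<^sup>+x. h (B *v x) \<partial>lborel)"
proof -
  have isometry: "det S \<noteq> 0 \<longrightarrow> (\<forall>h\<in>borel_measurable borel.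
     (\<integral>\<^sup>+x. h x \<partial>lborel) = ennreal \<bar>det S\<bar> * (\<integral>\<^sup>+x. h (S *v x) \<partial>lborel))"
    if norm: "\<And>x. norm (S *v x) = norm x" for S :: "real^'n^'n"
  proof -
    have "orthogonal_transformation ((*v) S)"
      using norm by (simp add: orthogonal_transformation)
    then have "\<bar>det S\<bar> = 1"
      using orthogonal_transformation_det by fastforce
    then show ?thesis
      using nn_integral_linear_isometry[of "(*v) S"] norm by simp
  qed
  have "det B \<noteq> 0 \<longrightarrow> (\<forall>h\<in>borel_measurable borel.
     (\<integral>\<^sup>+x. h x \<partial>lborel) = ennreal \<bar>det B\<bar> * (\<integral>\<^sup>+x. h (B *v x) \<partial>lborel))" (is "?P B")
  proof (induction B rule: induct_matrix_elementary)
    case (1 A B)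
    show ?case
    proof (intro impI ballI)
      fix h :: "real^'n \<Rightarrow> ennreal" assume [measurable]: "h \<in> borel_measurable borel" and d: "det (A ** B) \<noteq> 0"
      have [measurable]: "(*v) A \<in> borel_measurable borel" by (intro borel_measurable_linear) simp
      from d have "det A \<noteq> 0" "det B \<noteq> 0" by (auto simp: det_mul)
      then have "(\<integral>\<^sup>+x. h x \<partial>lborel) = ennreal \<bar>det A\<bar> * (\<integral>\<^sup>+x. h (A *v x) \<partial>lborel)"
        using bspec[OF mp[OF 1(1)], of h] by simp
      also have "(\<integral>\<^sup>+x. h (A *v x) \<partial>lborel) = ennreal \<bar>det B\<bar> * (\<integral>\<^sup>+x. h (A *v (B *v x)) \<partial>lborel)"
        using bspec[OF mp[OF 1(2) \<open>det B \<noteq> 0\<close>], of "\<lambda>x. h (A *v x)"] by simp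
      finally show "(\<integral>\<^sup>+x. h x \<partial>lborel) = ennreal \<bar>det (A ** B)\<bar> * (\<integral>\<^sup>+x. h ((A ** B) *v x) \<partial>lborel)"
        by (simp only: det_mul abs_mult) (simp add: ennreal_mult mult.assoc flip: matrix_vector_mul_assoc)
    qed
  next
    case (2 A i)
    then show ?case by (simp add: det_zero_row row_def vec_eq_iff)
  next
    case (3 A)
    show ?case
    proof (intro impI ballI)
      fix h :: "real^'n \<Rightarrow> ennreal" assume [measurable]: "h \<in> borel_measurable borel" and d: "det A \<noteq> 0"
      define T where "T x = 0 + (\<Sum>b\<in>Basis. ((\<Sum>i\<in>UNIV. A $ i $ i * b $ i) * (x \<bullet> b)) *\<^sub>R b)" for x :: "real^'n"
      have dA: "det A = (\<Prod>i\<in>UNIV. A $ i $ i)" using 3 by (rule det_diagonal)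
      have [measurable]: "T \<in> borel_measurable borel" unfolding T_def by measurable
      have B: "(Basis :: (real^'n) set) = (\<lambda>i. axis i 1) ` (UNIV :: 'n set)" by (auto simp: Basis_vec_def axis_eq_axis)
      have cf: "(\<Sum>i\<in>UNIV. A $ i $ i * axis k 1 $ i) = A $ k $ k" for k
        by (simp add: axis_def if_distrib cong: if_cong)
      have "T x = A *v x" for x
      proof (rule euclidean_eqI)
        fix b :: "real^'n" assume b: "b \<in> Basis"
        then obtain k where k: "b = axis k 1" unfolding B by auto
        have "(\<Sum>j\<in>UNIV. A $ k $ j * x $ j) = (\<Sum>j\<in>UNIV. if j = k then A $ k $ k * x $ k else 0)"
          by (rule sum.cong) (auto simp: 3)
        then show "T x \<bullet> b = (A *v x) \<bullet> b"
          unfolding T_def using b cf[of k]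
          by (simp add: inner_sum_left_Basis) (simp add: k inner_axis matrix_vector_mult_def)
      qed
      then have T: "T = (*v) A" by auto
      have prod: "(\<Prod>b\<in>Basis. \<bar>\<Sum>i\<in>UNIV. A $ i $ i * b $ i\<bar>) = \<bar>det A\<bar>"
        unfolding B by (subst prod.reindex) (auto simp: inj_on_def axis_eq_axis cf dA abs_prod)
      have nz: "(\<Sum>i\<in>UNIV. A $ i $ i * b $ i) \<noteq> 0" if "b \<in> Basis" for b
        using that d unfolding B dA by (auto simp: cf)
      have "(\<integral>\<^sup>+x. h x \<partial>lborel) = ennreal \<bar>det A\<bar> * (\<integral>\<^sup>+x. h (T x) \<partial>lborel)"
        unfolding prod[symmetric]
        by (subst lborel_affine_euclidean[where c="\<lambda>b. \<Sum>i\<in>UNIV. A $ i $ i * b $ i" and t=0, OF nz], assumption)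
           (simp only: nn_integral_density nn_integral_distr nn_integral_cmult T_def[symmetric],
            simp add: nn_integral_density nn_integral_distr nn_integral_cmult)
      then show "(\<integral>\<^sup>+x. h x \<partial>lborel) = ennreal \<bar>det A\<bar> * (\<integral>\<^sup>+x. h (A *v x) \<partial>lborel)"
        by (simp add: T)
    qed
  next
    case (4 m n)
    let ?S = "\<chi> i j. mat 1 $ i $ Transposition.transpose m n j :: real^'n^'n"
    have S: "(?S *v x) $ i = x $ Transposition.transpose m n i" for x i
    proof -
      have "(\<Sum>j\<in>UNIV. mat 1 $ i $ Transposition.transpose m n j * x $ j)
          = (\<Sum>j\<in>UNIV. if j = Transposition.transpose m n i then x $ j else 0)"
        by (intro sum.cong) (auto simp: mat_def)
      then show ?thesis by (simp add: matrix_vector_mult_def)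
    qed
    have "norm (?S *v x) = norm x" for x
    proof -
      have "(\<Sum>i\<in>UNIV. x $ Transposition.transpose m n i * x $ Transposition.transpose m n i) = (\<Sum>i\<in>UNIV. x $ i * x $ i)"
        using sum.permute[of "Transposition.transpose m n" UNIV "\<lambda>i. x $ i * x $ i"]
        by (simp add: permutes_swap_id o_def)
      then show ?thesis by (simp add: norm_eq_sqrt_inner inner_vec_def S)
    qed
    then show ?case by (rule isometry)
  next
    case (5 m n c)
    let ?S = "\<chi> i j. if i = m \<and> j = n then c else of_bool (i = j) :: real^'n^'n"
    define D :: "real^'n \<Rightarrow> real^'n" where "D x = (\<chi> i. if i = m then - x $ i else x $ i)" for x
    have S: "?S *v x = (\<chi> i. if i = m then x $ m + c * x $ n else x $ i)" for x
    proof -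
      have "(\<Sum>j\<in>UNIV. (if i = m \<and> j = n then c else of_bool (i = j)) * x $ j)
          = (\<Sum>j\<in>UNIV. (if j = i then x $ i else 0) + (if j = n then if i = m then c * x $ n else 0 else 0))" for i
        using 5 by (intro sum.cong) auto
      also have "\<dots> i = x $ i + (if i = m then c * x $ n else 0)" for i
        by (simp add: sum.distrib)
      finally show ?thesis by (auto simp: matrix_vector_mult_def vec_eq_iff)
    qed
    have "D x \<bullet> D x = x \<bullet> x" for x
      unfolding inner_vec_def by (rule sum.cong) (auto simp: D_def)
    moreover have "linear D"
      by (auto intro!: linearI simp: D_def vec_eq_iff)
    ultimately have D: "linear D" "norm (D x) = norm x" for x
      by (auto simp: norm_eq_sqrt_inner)
    have DSDS: "D (?S *v D (?S *v x)) = x" and SDSD: "?S *v D (?S *v D x) = x" for x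
      unfolding S D_def using 5 by (auto simp: vec_eq_iff)
    have "inj ((*v) ?S)"
      by (rule inj_on_inverseI[of _ "\<lambda>y. D (?S *v D y)"]) (rule DSDS)
    moreover have "surj ((*v) ?S)"
      by (rule surjI[of _ "\<lambda>y. D (?S *v D y)"]) (rule SDSD)
    ultimately obtain k where k: "k > 0" "\<And>h. h \<in> borel_measurable borel \<Longrightarrow>
       (\<integral>\<^sup>+y. h y \<partial>lborel) = ennreal k * (\<integral>\<^sup>+x. h (?S *v x) \<partial>lborel)"
      using nn_integral_linear_scaling[of "(*v) ?S"] by auto
    note [measurable] = borel_measurable_linear[OF D(1)] borel_measurable_linear[OF matrix_vector_mul_linear, of ?S]
    have step: "(\<integral>\<^sup>+y. h y \<partial>lborel) = ennreal k * (\<integral>\<^sup>+x. h (D (?S *v x)) \<partial>lborel)"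
      if [measurable]: "h \<in> borel_measurable borel" for h :: "real^'n \<Rightarrow> ennreal"
      using k(2)[of "\<lambda>x. h (D x)"] nn_integral_linear_isometry[OF D refl that] by simp
    define g :: "real^'n \<Rightarrow> ennreal" where "g = indicator (ball 0 1)"
    have [measurable]: "g \<in> borel_measurable borel" by (simp add: g_def borel_measurable_indicator)
    \<comment> \<open>Two applications of \<open>step\<close> give \<open>D S D S\<close>, the identity map, so the factor \<open>k * k\<close> does nothing.\<close>
    have "(\<integral>\<^sup>+x. g x \<partial>lborel) = ennreal k * (ennreal k * (\<integral>\<^sup>+x. g x \<partial>lborel))"
      using step[of g] step[of "\<lambda>x. g (D (?S *v x))"] by (simp only: DSDS) measurable
    then have "emeasure lborel (ball 0 1 :: (real^'n) set) = ennreal k * (ennreal k * emeasure lborel (ball 0 1 :: (real^'n) set))"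
      by (simp add: g_def)
    then have "k * k = 1"
      using k(1) unit_ball_vol_pos[of "real CARD('n)", THEN less_imp_neq] by (simp add: emeasure_ball ennreal_mult'[symmetric])
    then have "k = 1" using k(1) by (simp add: square_eq_1_iff)
    have "?S = (\<chi> k. if k = m then row m (mat 1) + c *s row n (mat 1) else row k (mat 1))"
      using 5 by (auto simp: vec_eq_iff row_def mat_def)
    then have "det ?S = 1"
      using det_row_operation[OF 5, of "mat 1" c] by (simp add: det_I)
    then show ?case
      by (intro impI ballI) (subst k(2), auto simp: \<open>k = 1\<close>)
  qed
  then show ?thesis using assms by blast
qed

section \<open>Singular matrices form a null set\<close>

text \<open>Translating \<open>Z\<close> along \<open>v\<close> by \<open>t\<close> does not change its measure. Averaging over \<open>t\<close> in the unit interval and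
  exchanging the integrals measures, for each \<open>x\<close>, the set of \<open>t\<close> with \<open>x + t *\<^sub>R v\<close> in \<open>Z\<close>, which is null.\<close>

lemma null_set_of_countable_lines:
  fixes Z :: "'a::euclidean_space set"
  assumes [measurable]: "Z \<in> sets borel" and "\<And>x. countable {t::real. x + t *\<^sub>R v \<in> Z}"
  shows "Z \<in> null_sets lborel"
proof -
  have "emeasure lborel Z = (\<integral>\<^sup>+t. indicator {0..1} t * emeasure lborel Z \<partial>(lborel :: real measure))"
    by (simp add: nn_integral_multc)
  also have "\<dots> = (\<integral>\<^sup>+t. \<integral>\<^sup>+x. indicator {0..1} t * indicator Z (x + t *\<^sub>R v) \<partial>lborel \<partial>(lborel :: real measure))"
  proof (rule nn_integral_cong)
    fix t :: real
    show "indicator {0..1} t * emeasure lborel Z = (\<integral>\<^sup>+x. indicator {0..1} t * indicator Z (x + t *\<^sub>R v) \<partial>lborel)"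
      using nn_integral_lborel_translate[of "indicator Z" "t *\<^sub>R v"]
      by (simp add: nn_integral_cmult add.commute)
  qed
  also have "\<dots> = (\<integral>\<^sup>+x. \<integral>\<^sup>+t. indicator {0..1} t * indicator Z (x + t *\<^sub>R v) \<partial>(lborel :: real measure) \<partial>lborel)"
    by (rule lborel_pair.Fubini') measurable
  also have "\<dots> = (\<integral>\<^sup>+x. 0 \<partial>(lborel :: 'a measure))"
  proof (rule nn_integral_cong)
    fix x
    have "{t. x + t *\<^sub>R v \<in> Z} \<in> null_sets lborel"
      using assms(2) by (rule countable_imp_null_set_lborel)
    then have "AE t in lborel. t \<notin> {t. x + t *\<^sub>R v \<in> Z}" by (rule AE_not_in)
    then have "AE t in lborel. indicator {0..1} t * indicator Z (x + t *\<^sub>R v) = (0 :: ennreal)"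
      by eventually_elim simp
    then show "(\<integral>\<^sup>+t. indicator {0..1} t * indicator Z (x + t *\<^sub>R v) \<partial>(lborel :: real measure)) = 0"
      by (subst nn_integral_0_iff_AE) auto
  qed
  finally show ?thesis by (simp add: null_sets_def)
qed

text \<open>The determinant is a polynomial in \<open>t\<close>. It does not vanish identically because \<open>B + t *\<^sub>R mat 1\<close> is
  injective as soon as \<open>t\<close> exceeds the operator norm of \<open>B\<close>.\<close>

lemma finite_det_line_zeros:
  fixes B :: "real^'n::finite^'n"
  shows "finite {t. det (B + t *\<^sub>R mat 1) = 0}"
proof -
  define p :: "real poly" where "p = (\<Sum>\<pi> | \<pi> permutes (UNIV :: 'n set).
     smult (of_int (sign \<pi>)) (\<Prod>i\<in>UNIV. [: B $ i $ \<pi> i, mat 1 $ i $ \<pi> i :]))"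
  have p: "poly p t = det (B + t *\<^sub>R mat 1)" for t
    by (simp add: p_def det_def poly_sum poly_prod)
  obtain K where K: "K > 0" "\<And>x. norm (B *v x) \<le> norm x * K"
    using bounded_linear.pos_bounded[OF matrix_vector_mul_bounded_linear[of B]] by blast
  have "det (B + (K + 1) *\<^sub>R mat 1) \<noteq> 0"
  proof -
    have "x = 0" if "(B + (K + 1) *\<^sub>R mat 1) *v x = 0" for x
    proof -
      have "B *v x = - ((K + 1) *\<^sub>R x)"
        using that by (simp add: matrix_vector_mult_add_rdistrib scaleR_matrix_vector_assoc[symmetric] eq_neg_iff_add_eq_0)
      then have "(K + 1) * norm x \<le> norm x * K"
        using K(2)[of x] K(1) by simp
      then show ?thesis by (simp add: algebra_simps)
    qed
    then show ?thesis
      by (meson matrix_left_invertible_ker invertible_left_inverse invertible_det_nz)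
  qed
  then have "p \<noteq> 0" using p[of "K + 1"] by auto
  then show ?thesis using poly_roots_finite[of p] by (simp add: p)
qed

section \<open>Matrices as pairs of blocks\<close>

lemma borel_measurable_vec_nth [measurable (raw)]:
  fixes f :: "'a \<Rightarrow> 'b::euclidean_space ^ 'n::finite"
  assumes [measurable]: "f \<in> borel_measurable M"
  shows "(\<lambda>x. f x $ i) \<in> borel_measurable M"
proof -
  have [measurable]: "(\<lambda>y :: 'b ^ 'n. y $ i) \<in> borel_measurable borel"
    by (intro borel_measurable_continuous_onI continuous_intros)
  show ?thesis by measurable
qed

lemma borel_measurable_vec_lambda [measurable (raw)]:
  fixes f :: "'a \<Rightarrow> 'n::finite \<Rightarrow> 'b::euclidean_space"
  assumes [measurable]: "\<And>i. (\<lambda>x. f x i) \<in> borel_measurable M"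
  shows "(\<lambda>x. \<chi> i. f x i) \<in> borel_measurable M"
proof (subst borel_measurable_euclidean_space, rule ballI)
  fix b :: "'b ^ 'n" assume "b \<in> Basis"
  then show "(\<lambda>x. (\<chi> i. f x i) \<bullet> b) \<in> borel_measurable M"
    by (simp add: inner_vec_def)
qed

lemma borel_measurable_det [measurable (raw)]:
  fixes f :: "'a \<Rightarrow> real ^ 'n::finite ^ 'n"
  assumes [measurable]: "f \<in> borel_measurable M"
  shows "(\<lambda>x. det (f x)) \<in> borel_measurable M"
  unfolding det_def by measurable

lemma borel_measurable_matrix_vector_mult [measurable (raw)]:
  fixes f :: "'a \<Rightarrow> real ^ 'n::finite ^ 'm::finite"
  assumes [measurable]: "f \<in> borel_measurable M" "g \<in> borel_measurable M"
  shows "(\<lambda>x. f x *v g x) \<in> borel_measurable M"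
  unfolding matrix_vector_mult_def by measurable

text \<open>The inverse of the decomposition of \<open>A\<close> into its two blocks. It takes a pair, not two arguments, so
  that it is a linear map between Euclidean spaces.\<close>

definition join_blocks :: "(real ^ 'm::finite ^ 'm) \<times> (real ^ 'n::finite ^ 'm) \<Rightarrow> real ^ ('m + 'n) ^ 'm" where
  "join_blocks P = (\<chi> i j. case j of Inl k \<Rightarrow> fst P $ i $ k | Inr k \<Rightarrow> snd P $ i $ k)"

lemma left_block_join [simp]: "left_block (join_blocks (B, X)) = B"
  and right_block_join [simp]: "right_block (join_blocks (B, X)) = X"
  by (simp_all add: left_block_def right_block_def join_blocks_def vec_eq_iff)

lemma inner_join_blocks: "join_blocks (B, X) \<bullet> join_blocks (B, X) = B \<bullet> B + X \<bullet> X"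
  by (simp add: inner_vec_def join_blocks_def sum.distrib sum.Plus flip: UNIV_Plus_UNIV)

lemma linear_join_blocks: "linear join_blocks"
  by (rule linearI) (auto simp: join_blocks_def vec_eq_iff split: sum.split)

lemma nn_integral_join_blocks:
  fixes h :: "real ^ ('m::finite + 'n::finite) ^ 'm \<Rightarrow> ennreal"
  assumes [measurable]: "h \<in> borel_measurable borel"
  shows "(\<integral>\<^sup>+A. h A \<partial>lborel) = (\<integral>\<^sup>+B. \<integral>\<^sup>+X. h (join_blocks (B, X)) \<partial>lborel \<partial>lborel)"
proof -
  note [measurable] = borel_measurable_linear[OF linear_join_blocks]
  have "norm (join_blocks P) = norm P" for P :: "(real ^ 'm ^ 'm) \<times> (real ^ 'n ^ 'm)"
    by (cases P) (simp add: norm_eq_sqrt_inner inner_join_blocks)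
  then have "(\<integral>\<^sup>+A. h A \<partial>lborel) = (\<integral>\<^sup>+P. h (join_blocks P) \<partial>lborel)"
    by (intro nn_integral_linear_isometry[symmetric] linear_join_blocks) (auto simp: algebra_simps)
  also have "\<dots> = (\<integral>\<^sup>+B. \<integral>\<^sup>+X. h (join_blocks (B, X)) \<partial>lborel \<partial>lborel)"
    by (subst lborel_prod[symmetric], subst lborel.nn_integral_fst) (simp_all add: lborel_prod)
  finally show ?thesis .
qed

section \<open>Completing the square in the two blocks\<close>

lemma inner_matrix_mul_orthogonal:
  fixes X :: "real ^ 'k::finite ^ 'm::finite"
  assumes "orthogonal_matrix Q"
  shows "(X ** Q) \<bullet> (X ** Q) = X \<bullet> X"
proof -
  have "orthogonal_transformation ((*v) (transpose Q))"
    using assms by (simp add: orthogonal_transformation_matrix)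
  then have "(transpose Q *v x) \<bullet> (transpose Q *v x) = x \<bullet> x" for x
    by (simp add: orthogonal_transformation_def)
  moreover have "(X ** Q) $ i = transpose Q *v X $ i" for i
    by (simp add: vec_eq_iff matrix_matrix_mult_def matrix_vector_mult_def transpose_def mult.commute)
  ultimately show ?thesis
    by (simp add: inner_vec_def[of X] inner_vec_def[of "X ** Q"])
qed

text \<open>Multiplication by an orthogonal matrix from the right rotates each row, hence is an isometry of
  the whole matrix space. It serves to turn a parameter vector into a multiple of a coordinate axis,
  so that the vector enters only through one column.\<close>

lemma nn_integral_matrix_mul_orthogonal:
  fixes h :: "real ^ 'k::finite ^ 'm::finite \<Rightarrow> ennreal"
  assumes Q: "orthogonal_matrix Q" and "h \<in> borel_measurable borel"
  shows "(\<integral>\<^sup>+X. h (X ** Q) \<partial>lborel) = (\<integral>\<^sup>+X. h X \<partial>lborel)"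
proof (rule nn_integral_linear_isometry)
  show "linear (\<lambda>X :: real ^ 'k ^ 'm. X ** Q)"
    by (rule linearI) (auto simp: vec_eq_iff matrix_matrix_mult_def algebra_simps sum.distrib sum_distrib_left)
qed (use assms in \<open>auto simp: norm_eq_sqrt_inner inner_matrix_mul_orthogonal\<close>)

lemma orthogonal_matrix_to_axis:
  fixes w :: "real ^ 'k::finite" and e :: 'k
  obtains Q :: "real ^ 'k ^ 'k" where "orthogonal_matrix Q" "Q *v w = norm w *\<^sub>R axis e 1"
proof -
  have eq: "norm w = norm (norm w *\<^sub>R axis e 1 :: real ^ 'k)"
    by (simp add: norm_axis_1)
  obtain f :: "real ^ 'k \<Rightarrow> real ^ 'k" where "orthogonal_transformation f" "f w = norm w *\<^sub>R axis e 1"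
    by (rule orthogonal_transformation_exists[OF eq]) blast
  then show ?thesis
    using that[of "matrix f"] matrix_works[of f w] by (simp add: orthogonal_transformation_matrix)
qed

lemma inner_column_affine:
  fixes X :: "real ^ 'k::finite ^ 'm::finite"
  shows "(\<chi> i j. if j = e then s $ i + c * X $ i $ j else X $ i $ j) \<bullet> (\<chi> i j. if j = e then s $ i + c * X $ i $ j else X $ i $ j)
    = X \<bullet> X + (\<Sum>i\<in>UNIV. (s $ i + c * X $ i $ e)\<^sup>2 - (X $ i $ e)\<^sup>2)"
proof -
  have "(\<Sum>j\<in>UNIV. (if j = e then s $ i + c * X $ i $ j else X $ i $ j) * (if j = e then s $ i + c * X $ i $ j else X $ i $ j))
      = (\<Sum>j\<in>UNIV. X $ i $ j * X $ i $ j + (if j = e then (s $ i + c * X $ i $ e)\<^sup>2 - (X $ i $ e)\<^sup>2 else 0))" for i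
    by (rule sum.cong) (auto simp: power2_eq_square)
  then show ?thesis
    by (simp add: inner_vec_def sum.distrib)
qed

text \<open>Integrating out the right block. After a rotation that sends \<open>u\<close> to \<open>norm u\<close> times an axis, \<open>X *v u\<close> is
  \<open>norm u\<close> times one column \<open>x\<close>, and completing the square entrywise,
  \<open>x\<^sup>2 + (s + norm u * x)\<^sup>2 = (\<beta> * x + norm u * s / \<beta>)\<^sup>2 + s\<^sup>2 / \<beta>\<^sup>2\<close>,
  shows that an affine substitution in this column decouples \<open>X\<close> from \<open>s\<close>.\<close>

lemma nn_integral_complete_square:
  fixes \<phi> :: "real \<Rightarrow> ennreal" and u :: "real ^ 'n::finite" and s :: "real ^ 'm::finite"
  assumes [measurable]: "\<phi> \<in> borel_measurable borel"
  defines "\<beta> \<equiv> sqrt (1 + u \<bullet> u)"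
  shows "(\<integral>\<^sup>+(X :: real ^ 'n ^ 'm). \<phi> (r + s \<bullet> s / \<beta>\<^sup>2 + X \<bullet> X) \<partial>lborel)
    = ennreal (\<beta> ^ CARD('m)) * (\<integral>\<^sup>+(X :: real ^ 'n ^ 'm). \<phi> (r + X \<bullet> X + (s + X *v u) \<bullet> (s + X *v u)) \<partial>lborel)"
proof -
  \<comment> \<open>The axis onto which \<open>u\<close> is rotated; any choice serves.\<close>
  fix e :: 'n
  have \<beta>2: "\<beta>\<^sup>2 = 1 + (norm u)\<^sup>2" by (simp add: \<beta>_def power2_norm_eq_inner add_nonneg_nonneg)
  have \<beta>: "\<beta> > 0" by (simp add: \<beta>_def add_pos_nonneg)
  \<comment> \<open>The shift that completes the square in the column singled out.\<close>
  define t where "t = (norm u / \<beta>) *\<^sub>R s"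
  let ?T = "\<lambda>X :: real ^ 'n ^ 'm. (\<chi> i j. if j = e then t $ i + \<beta> * X $ i $ j else X $ i $ j) :: real ^ 'n ^ 'm"
  obtain Q where Q: "orthogonal_matrix Q" "Q *v u = norm u *\<^sub>R axis e 1"
    by (rule orthogonal_matrix_to_axis)
  have square: "s \<bullet> s / \<beta>\<^sup>2 + ?T X \<bullet> ?T X = X \<bullet> X + (s + (X ** Q) *v u) \<bullet> (s + (X ** Q) *v u)" for X
  proof -
    have col: "((X ** Q) *v u) $ i = norm u * X $ i $ e" for i
    proof -
      have "((X ** Q) *v u) $ i = (\<Sum>j\<in>UNIV. X $ i $ j * (norm u * axis e 1 $ j))"
        by (simp add: Q(2) flip: matrix_vector_mul_assoc) (simp add: matrix_vector_mult_def)
      also have "\<dots> = (\<Sum>j\<in>UNIV. if j = e then norm u * X $ i $ e else 0)"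
        by (rule sum.cong) (auto simp: axis_def)
      finally show ?thesis by simp
    qed
    have "s $ i * s $ i / \<beta>\<^sup>2 + ((t $ i + \<beta> * X $ i $ e)\<^sup>2 - (X $ i $ e)\<^sup>2)
        = (s $ i + norm u * X $ i $ e) * (s $ i + norm u * X $ i $ e)" for i
    proof -
      have "(t $ i)\<^sup>2 = (norm u)\<^sup>2 * (s $ i)\<^sup>2 / \<beta>\<^sup>2"
        by (simp add: t_def power_mult_distrib power_divide)
      then have "(s $ i)\<^sup>2 / \<beta>\<^sup>2 + (t $ i)\<^sup>2 = (1 + (norm u)\<^sup>2) * (s $ i)\<^sup>2 / \<beta>\<^sup>2"
        by (simp add: distrib_right add_divide_distrib)
      also have "\<dots> = (s $ i)\<^sup>2" using \<beta> by (simp flip: \<beta>2)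
      finally have 1: "(s $ i)\<^sup>2 / \<beta>\<^sup>2 + (t $ i)\<^sup>2 = (s $ i)\<^sup>2" .
      have 2: "t $ i * \<beta> = norm u * s $ i" using \<beta> by (simp add: t_def)
      have 3: "(\<beta> * X $ i $ e)\<^sup>2 - (X $ i $ e)\<^sup>2 = (norm u * X $ i $ e)\<^sup>2"
        by (simp add: power_mult_distrib \<beta>2 algebra_simps)
      have "s $ i * s $ i / \<beta>\<^sup>2 + ((t $ i + \<beta> * X $ i $ e)\<^sup>2 - (X $ i $ e)\<^sup>2)
        = ((s $ i)\<^sup>2 / \<beta>\<^sup>2 + (t $ i)\<^sup>2) + 2 * (t $ i * \<beta>) * X $ i $ e + ((\<beta> * X $ i $ e)\<^sup>2 - (X $ i $ e)\<^sup>2)"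
        by (simp add: power2_eq_square algebra_simps)
      then show ?thesis
        unfolding 1 2 3 by (simp add: power2_eq_square algebra_simps)
    qed
    then show ?thesis
      unfolding inner_column_affine
      by (simp add: inner_vec_def[of s] inner_vec_def[of "s + _"] col sum_divide_distrib flip: sum.distrib)
  qed
  have "(\<integral>\<^sup>+(X :: real ^ 'n ^ 'm). \<phi> (r + s \<bullet> s / \<beta>\<^sup>2 + X \<bullet> X) \<partial>lborel)
    = ennreal (\<bar>\<beta>\<bar> ^ CARD('m)) * (\<integral>\<^sup>+X. \<phi> (r + s \<bullet> s / \<beta>\<^sup>2 + ?T X \<bullet> ?T X) \<partial>lborel)"
    using \<beta> by (intro nn_integral_column_affine) auto
  also have "(\<integral>\<^sup>+X. \<phi> (r + s \<bullet> s / \<beta>\<^sup>2 + ?T X \<bullet> ?T X) \<partial>lborel)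
    = (\<integral>\<^sup>+(X :: real ^ 'n ^ 'm). \<phi> (r + (X ** Q) \<bullet> (X ** Q) + (s + (X ** Q) *v u) \<bullet> (s + (X ** Q) *v u)) \<partial>lborel)"
    by (simp add: add.assoc square inner_matrix_mul_orthogonal[OF Q(1)])
  also have "\<dots> = (\<integral>\<^sup>+(X :: real ^ 'n ^ 'm). \<phi> (r + X \<bullet> X + (s + X *v u) \<bullet> (s + X *v u)) \<partial>lborel)"
    by (rule nn_integral_matrix_mul_orthogonal[OF Q(1)]) measurable
  finally show ?thesis using \<beta> by (simp only: abs_of_pos)
qed

lemma det_column_scale:
  fixes B :: "real ^ 'm::finite ^ 'm"
  shows "det (\<chi> i j. if j = e then c * B $ i $ j else B $ i $ j) = c * det B"
proof -
  have "det (\<chi> i j. if j = e then c * B $ i $ j else B $ i $ j)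
      = det (\<chi> j. if j = e then c *s column j B else column j B)"
    by (subst det_transpose[symmetric]) (rule arg_cong[of _ _ det], auto simp: transpose_def column_def vec_eq_iff)
  also have "\<dots> = c * det (\<chi> j. if j = e then column j B else column j B)"
    by (rule det_row_mul)
  also have "(\<chi> j. if j = e then column j B else column j B) = transpose B"
    by (simp add: transpose_def column_def vec_eq_iff)
  finally show ?thesis by simp
qed

text \<open>Integrating out the left block. After a rotation that sends \<open>w\<close> to \<open>norm w\<close> times an axis, the added
  term stretches the quadratic form in one column by \<open>\<gamma>\<^sup>2\<close>. Rescaling that column by \<open>\<gamma>\<close> costs \<open>\<gamma> ^ m\<close> from
  the \<open>m\<close> entries of the column and one more factor \<open>\<gamma>\<close> from the determinant: this extra factor
  produces the exponent \<open>m + 1\<close> of the final density.\<close>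

lemma nn_integral_det_stretch:
  fixes \<psi> :: "real \<Rightarrow> ennreal" and w :: "real ^ 'm::finite"
  assumes [measurable]: "\<psi> \<in> borel_measurable borel"
  defines "\<gamma> \<equiv> sqrt (1 + w \<bullet> w)"
  shows "(\<integral>\<^sup>+(B :: real ^ 'm ^ 'm). ennreal \<bar>det B\<bar> * \<psi> (B \<bullet> B) \<partial>lborel)
    = ennreal (\<gamma> ^ (CARD('m) + 1)) * (\<integral>\<^sup>+(B :: real ^ 'm ^ 'm). ennreal \<bar>det B\<bar> * \<psi> (B \<bullet> B + (B *v w) \<bullet> (B *v w)) \<partial>lborel)"
proof -
  \<comment> \<open>The axis onto which \<open>w\<close> is rotated; any choice serves.\<close>
  fix e :: 'm
  have \<gamma>2: "\<gamma>\<^sup>2 = 1 + (norm w)\<^sup>2" by (simp add: \<gamma>_def power2_norm_eq_inner add_nonneg_nonneg)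
  have \<gamma>: "\<gamma> > 0" by (simp add: \<gamma>_def add_pos_nonneg)
  let ?T = "\<lambda>B :: real ^ 'm ^ 'm. (\<chi> i j. if j = e then 0 $ i + \<gamma> * B $ i $ j else B $ i $ j) :: real ^ 'm ^ 'm"
  obtain Q where Q: "orthogonal_matrix Q" "Q *v w = norm w *\<^sub>R axis e 1"
    by (rule orthogonal_matrix_to_axis)
  have square: "?T B \<bullet> ?T B = B \<bullet> B + ((B ** Q) *v w) \<bullet> ((B ** Q) *v w)" for B
  proof -
    have col: "((B ** Q) *v w) $ i = norm w * B $ i $ e" for i
    proof -
      have "((B ** Q) *v w) $ i = (\<Sum>j\<in>UNIV. B $ i $ j * (norm w * axis e 1 $ j))"
        by (simp add: Q(2) flip: matrix_vector_mul_assoc) (simp add: matrix_vector_mult_def)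
      also have "\<dots> = (\<Sum>j\<in>UNIV. if j = e then norm w * B $ i $ e else 0)"
        by (rule sum.cong) (auto simp: axis_def)
      finally show ?thesis by simp
    qed
    have "(\<gamma> * B $ i $ e)\<^sup>2 - (B $ i $ e)\<^sup>2 = (norm w * B $ i $ e) * (norm w * B $ i $ e)" for i
      by (simp add: power_mult_distrib \<gamma>2 algebra_simps) (simp add: power2_eq_square)
    then show ?thesis
      unfolding inner_column_affine by (simp add: inner_vec_def[of "_ *v w"] col)
  qed
  have const: "ennreal (\<bar>\<gamma>\<bar> ^ CARD('m)) * ennreal \<gamma> = ennreal (\<gamma> ^ (CARD('m) + 1))"
    using \<gamma> by (simp add: mult.commute flip: ennreal_mult')
  have det: "\<bar>det (?T B)\<bar> = \<gamma> * \<bar>det (B ** Q)\<bar>" for B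
  proof -
    have "?T B = (\<chi> i j. if j = e then \<gamma> * B $ i $ j else B $ i $ j)"
      by (simp add: vec_eq_iff)
    then show ?thesis
      using \<gamma> det_orthogonal_matrix[OF Q(1)] by (auto simp only: det_column_scale det_mul abs_mult)
  qed
  have "(\<integral>\<^sup>+(B :: real ^ 'm ^ 'm). ennreal \<bar>det B\<bar> * \<psi> (B \<bullet> B) \<partial>lborel)
    = ennreal (\<bar>\<gamma>\<bar> ^ CARD('m)) * (\<integral>\<^sup>+B. ennreal \<bar>det (?T B)\<bar> * \<psi> (?T B \<bullet> ?T B) \<partial>lborel)"
    using \<gamma> by (intro nn_integral_column_affine) auto
  also have "(\<integral>\<^sup>+B. ennreal \<bar>det (?T B)\<bar> * \<psi> (?T B \<bullet> ?T B) \<partial>lborel)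
    = (\<integral>\<^sup>+B. ennreal \<gamma> * (ennreal \<bar>det (B ** Q)\<bar> * \<psi> ((B ** Q) \<bullet> (B ** Q) + ((B ** Q) *v w) \<bullet> ((B ** Q) *v w))) \<partial>lborel)"
    unfolding det square using \<gamma> by (simp add: inner_matrix_mul_orthogonal[OF Q(1)] ennreal_mult mult.assoc)
  also have "\<dots> = (\<integral>\<^sup>+(B :: real ^ 'm ^ 'm). ennreal \<gamma> * (ennreal \<bar>det B\<bar> * \<psi> (B \<bullet> B + (B *v w) \<bullet> (B *v w))) \<partial>lborel)"
    by (rule nn_integral_matrix_mul_orthogonal[OF Q(1)]) measurable
  also have "\<dots> = ennreal \<gamma> * (\<integral>\<^sup>+(B :: real ^ 'm ^ 'm). ennreal \<bar>det B\<bar> * \<psi> (B \<bullet> B + (B *v w) \<bullet> (B *v w)) \<partial>lborel)"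
    by (rule nn_integral_cmult) measurable
  finally show ?thesis
    unfolding mult.assoc[symmetric] const .
qed

lemma borel_measurable_left_block [measurable]: "left_block \<in> borel_measurable borel"
  unfolding left_block_def by measurable

lemma borel_measurable_right_block [measurable]: "right_block \<in> borel_measurable borel"
  unfolding right_block_def by measurable

text \<open>The left side is the density of the solution at \<open>z\<close> once \<open>b\<close> has been expressed through \<open>z\<close>. The right
  block contributes \<open>\<beta>\<close> to the power \<open>- m\<close> and replaces \<open>z\<close> by \<open>w = z / \<beta>\<close>; the left block contributes \<open>\<gamma>\<close> to the
  power \<open>- (m + 1)\<close>. As \<open>\<gamma> * \<beta> = sqrt (\<beta>\<^sup>2 + z \<bullet> z)\<close>, one factor \<open>\<beta>\<close> remains in the numerator.\<close>

lemma nn_integral_universal_density: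
  fixes \<phi> :: "real \<Rightarrow> ennreal" and u :: "real ^ 'n::finite" and z :: "real ^ 'm::finite"
  assumes [measurable]: "\<phi> \<in> borel_measurable borel"
  defines "\<beta> \<equiv> sqrt (1 + u \<bullet> u)"
  shows "(\<integral>\<^sup>+(A :: real ^ ('m + 'n) ^ 'm). ennreal \<bar>det (left_block A)\<bar> *
            \<phi> (A \<bullet> A + (left_block A *v z + right_block A *v u) \<bullet> (left_block A *v z + right_block A *v u)) \<partial>lborel)
    = ennreal (\<beta> / (\<beta>\<^sup>2 + z \<bullet> z) powr ((real CARD('m) + 1) / 2)) *
      (\<integral>\<^sup>+(A :: real ^ ('m + 'n) ^ 'm). ennreal \<bar>det (left_block A)\<bar> * \<phi> (A \<bullet> A) \<partial>lborel)"
proof -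
  let ?m = "CARD('m)"
  let ?H = "\<integral>\<^sup>+(A :: real ^ ('m + 'n) ^ 'm). ennreal \<bar>det (left_block A)\<bar> *
    \<phi> (A \<bullet> A + (left_block A *v z + right_block A *v u) \<bullet> (left_block A *v z + right_block A *v u)) \<partial>lborel"
  let ?J = "\<integral>\<^sup>+(A :: real ^ ('m + 'n) ^ 'm). ennreal \<bar>det (left_block A)\<bar> * \<phi> (A \<bullet> A) \<partial>lborel"
  have \<beta>: "\<beta> > 0" by (simp add: \<beta>_def add_pos_nonneg)
  define w where "w = (1 / \<beta>) *\<^sub>R z"
  define \<gamma> where "\<gamma> = sqrt (1 + w \<bullet> w)"
  define \<psi> where "\<psi> r = (\<integral>\<^sup>+(X :: real ^ 'n ^ 'm). \<phi> (r + X \<bullet> X) \<partial>lborel)" for r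
  have [measurable]: "\<psi> \<in> borel_measurable borel" unfolding \<psi>_def by measurable
  have inner: "\<psi> (B \<bullet> B + (B *v w) \<bullet> (B *v w)) = ennreal (\<beta> ^ ?m) * (\<integral>\<^sup>+(X :: real ^ 'n ^ 'm).
      \<phi> (B \<bullet> B + X \<bullet> X + (B *v z + X *v u) \<bullet> (B *v z + X *v u)) \<partial>lborel)" for B :: "real ^ 'm ^ 'm"
  proof -
    have "(B *v w) \<bullet> (B *v w) = (B *v z) \<bullet> (B *v z) / \<beta>\<^sup>2"
      by (simp add: w_def power2_eq_square matrix_vector_mult_scaleR)
    then show ?thesis
      using nn_integral_complete_square[of \<phi> "B \<bullet> B" "B *v z" u]
      by (simp add: \<psi>_def \<beta>_def)
  qed
  have "?J = (\<integral>\<^sup>+(B :: real ^ 'm ^ 'm). ennreal \<bar>det B\<bar> * \<psi> (B \<bullet> B) \<partial>lborel)"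
    by (subst nn_integral_join_blocks) (simp_all add: inner_join_blocks nn_integral_cmult \<psi>_def)
  also have "\<dots> = ennreal (\<gamma> ^ (?m + 1)) * (\<integral>\<^sup>+(B :: real ^ 'm ^ 'm). ennreal \<bar>det B\<bar> * \<psi> (B \<bullet> B + (B *v w) \<bullet> (B *v w)) \<partial>lborel)"
    unfolding \<gamma>_def by (rule nn_integral_det_stretch) measurable
  also have "(\<integral>\<^sup>+(B :: real ^ 'm ^ 'm). ennreal \<bar>det B\<bar> * \<psi> (B \<bullet> B + (B *v w) \<bullet> (B *v w)) \<partial>lborel)
     = (\<integral>\<^sup>+(B :: real ^ 'm ^ 'm). ennreal (\<beta> ^ ?m) * (\<integral>\<^sup>+(X :: real ^ 'n ^ 'm). ennreal \<bar>det B\<bar> *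
         \<phi> (B \<bullet> B + X \<bullet> X + (B *v z + X *v u) \<bullet> (B *v z + X *v u)) \<partial>lborel) \<partial>lborel)"
    unfolding inner by (simp add: nn_integral_cmult mult_ac)
  also have "\<dots> = ennreal (\<beta> ^ ?m) * (\<integral>\<^sup>+(B :: real ^ 'm ^ 'm). (\<integral>\<^sup>+(X :: real ^ 'n ^ 'm). ennreal \<bar>det B\<bar> *
         \<phi> (B \<bullet> B + X \<bullet> X + (B *v z + X *v u) \<bullet> (B *v z + X *v u)) \<partial>lborel) \<partial>lborel)"
    by (rule nn_integral_cmult) measurable
  also have "(\<integral>\<^sup>+(B :: real ^ 'm ^ 'm). (\<integral>\<^sup>+(X :: real ^ 'n ^ 'm). ennreal \<bar>det B\<bar> *
         \<phi> (B \<bullet> B + X \<bullet> X + (B *v z + X *v u) \<bullet> (B *v z + X *v u)) \<partial>lborel) \<partial>lborel) = ?H"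
    by (subst nn_integral_join_blocks) (simp_all add: inner_join_blocks)
  finally have H0: "?J = ennreal (\<gamma> ^ (?m + 1)) * (ennreal (\<beta> ^ ?m) * ?H)" .
  have \<gamma>: "\<gamma> > 0" by (simp add: \<gamma>_def add_pos_nonneg)
  have "\<gamma> * \<beta> = sqrt (\<beta>\<^sup>2 + z \<bullet> z)"
  proof (rule real_sqrt_unique[symmetric])
    have "\<gamma>\<^sup>2 = 1 + (z \<bullet> z) / \<beta>\<^sup>2" by (simp add: \<gamma>_def w_def add_nonneg_nonneg power2_eq_square)
    then show "(\<gamma> * \<beta>)\<^sup>2 = \<beta>\<^sup>2 + z \<bullet> z" using \<beta> by (simp add: power_mult_distrib field_simps)
  qed (use \<gamma> \<beta> in auto)
  also have "\<dots> = (\<beta>\<^sup>2 + z \<bullet> z) powr (1 / 2)"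
    by (simp add: powr_half_sqrt add_nonneg_nonneg)
  finally have "(\<gamma> * \<beta>) powr real (?m + 1) = (\<beta>\<^sup>2 + z \<bullet> z) powr ((real ?m + 1) / 2)"
    by (simp add: powr_powr add.commute)
  then have "(\<beta>\<^sup>2 + z \<bullet> z) powr ((real ?m + 1) / 2) = (\<gamma> * \<beta>) ^ (?m + 1)"
    using \<beta> \<gamma> powr_realpow[of "\<gamma> * \<beta>" "?m + 1"] by simp
  \<comment> \<open>The two Jacobian factors are the reciprocal of the claimed density.\<close>
  then have const: "\<beta> / (\<beta>\<^sup>2 + z \<bullet> z) powr ((real ?m + 1) / 2) * (\<gamma> ^ (?m + 1) * \<beta> ^ ?m) = 1"
    using \<beta> \<gamma> by (simp add: power_mult_distrib)
  have "ennreal x * (ennreal a * ennreal b) = ennreal (x * (a * b))" if "x \<ge> 0" "a \<ge> 0" "b \<ge> 0" for x a b :: real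
    using that by (simp add: ennreal_mult)
  from this[of "\<beta> / (\<beta>\<^sup>2 + z \<bullet> z) powr ((real ?m + 1) / 2)" "\<gamma> ^ (?m + 1)" "\<beta> ^ ?m"]
  have "ennreal (\<beta> / (\<beta>\<^sup>2 + z \<bullet> z) powr ((real ?m + 1) / 2)) * (ennreal (\<gamma> ^ (?m + 1)) * ennreal (\<beta> ^ ?m)) = 1"
    unfolding const using \<beta> \<gamma> by simp
  then show ?thesis
    unfolding H0 mult.assoc[symmetric] by (simp only: mult_1)
qed

section \<open>Universality of the normalization constant\<close>

text \<open>Polar coordinates for a homogeneous weight \<open>h\<close>. The measure with density \<open>h\<close>, pushed forward by
  \<open>x \<mapsto> x \<bullet> x\<close>, gives the half-line up to \<open>a\<close> a mass proportional to \<open>a powr p\<close>, by rescaling to the unit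
  ball; so it has a density proportional to \<open>s powr (p - 1)\<close>. All dependence on \<open>\<phi>\<close> sits in one
  one-dimensional integral, the one that admissibility prescribes.\<close>

lemma nn_integral_homogeneous_radial:
  fixes h :: "'a::euclidean_space \<Rightarrow> ennreal" and \<phi> :: "real \<Rightarrow> ennreal" and k :: nat
  assumes [measurable]: "h \<in> borel_measurable borel" "\<phi> \<in> borel_measurable borel"
    and hom: "\<And>r x. r > 0 \<Longrightarrow> h (r *\<^sub>R x) = ennreal (r ^ k) * h x"
    and fin: "(\<integral>\<^sup>+x\<in>cball 0 1. h x \<partial>lborel) < \<infinity>"
  defines "p \<equiv> real (DIM('a) + k) / 2"
  shows "(\<integral>\<^sup>+x. h x * \<phi> (x \<bullet> x) \<partial>lborel)
    = (\<integral>\<^sup>+x\<in>cball 0 1. h x \<partial>lborel) * ennreal p * (\<integral>\<^sup>+s\<in>{0<..}. ennreal (s powr (p - 1)) * \<phi> s \<partial>lborel)"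
proof -
  define K where "K = (\<integral>\<^sup>+x\<in>cball 0 1. h x \<partial>lborel)"
  have p: "p > 0" by (simp add: p_def add_pos_nonneg)
  define \<mu> where "\<mu> = distr (density lborel h) borel (\<lambda>x. x \<bullet> x)"
  define \<nu> where "\<nu> = density lborel (\<lambda>s. K * ennreal p * (ennreal (s powr (p - 1)) * indicator {0<..} s))"
  have [measurable_cong, simp]: "sets \<mu> = sets borel" "sets \<nu> = sets borel"
    by (simp_all add: \<mu>_def \<nu>_def)
  have \<mu>: "emeasure \<mu> {..a} = (if a \<le> 0 then 0 else K * ennreal (a powr p))" for a
  proof -
    have "emeasure \<mu> {..a} = (\<integral>\<^sup>+s. indicator {..a} s \<partial>\<mu>)"
      by simp
    also have "\<dots> = (\<integral>\<^sup>+x. h x * indicator {..a} (x \<bullet> x) \<partial>lborel)"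
      unfolding \<mu>_def by (subst nn_integral_distr) (simp_all add: nn_integral_density)
    also have "\<dots> = (if a \<le> 0 then 0 else K * ennreal (a powr p))"
    proof (cases "a \<le> 0")
      case True
      have "AE x in lborel. x \<noteq> (0 :: 'a)" by (rule AE_lborel_singleton)
      then have "AE x in lborel. h x * indicator {..a} (x \<bullet> x) = 0"
      proof eventually_elim
        case (elim x)
        then have "0 < x \<bullet> x" by (rule inner_gt_zero_iff[THEN iffD2])
        then have "\<not> x \<bullet> x \<le> a" using True by linarith
        then show ?case by simp
      qed
      then have "(\<integral>\<^sup>+x. h x * indicator {..a} (x \<bullet> x) \<partial>lborel) = (\<integral>\<^sup>+x. 0 \<partial>(lborel :: 'a measure))"
        by (rule nn_integral_cong_AE)
      then show ?thesis using True by simp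
    next
      case False
      define r where "r = sqrt a"
      have r: "r > 0" "r * r = a" using False by (auto simp: r_def)
      have "(\<integral>\<^sup>+x. h x * indicator {..a} (x \<bullet> x) \<partial>lborel)
         = ennreal (r ^ DIM('a)) * (\<integral>\<^sup>+x. h (r *\<^sub>R x) * indicator {..a} ((r *\<^sub>R x) \<bullet> (r *\<^sub>R x)) \<partial>lborel)"
        using r by (subst nn_integral_lborel_affine[of _ r 0]) auto
      also have "(\<integral>\<^sup>+x. h (r *\<^sub>R x) * indicator {..a} ((r *\<^sub>R x) \<bullet> (r *\<^sub>R x)) \<partial>lborel)
         = (\<integral>\<^sup>+x. ennreal (r ^ k) * (h x * indicator (cball 0 1) x) \<partial>lborel)"
      proof (rule nn_integral_cong)
        fix x :: 'a
        have "(r *\<^sub>R x) \<bullet> (r *\<^sub>R x) = a * (norm x)\<^sup>2"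
          by (simp add: power2_norm_eq_inner r(2)[symmetric])
        then have "(r *\<^sub>R x) \<bullet> (r *\<^sub>R x) \<le> a \<longleftrightarrow> norm x \<le> 1"
          using False mult_le_cancel_left_pos[of a "(norm x)\<^sup>2" 1] by (simp add: abs_square_le_1)
        then show "h (r *\<^sub>R x) * indicator {..a} ((r *\<^sub>R x) \<bullet> (r *\<^sub>R x)) = ennreal (r ^ k) * (h x * indicator (cball 0 1) x)"
          using r by (simp add: hom indicator_def mult.assoc)
      qed
      also have "\<dots> = ennreal (r ^ k) * K"
        unfolding K_def by (rule nn_integral_cmult) (auto intro!: borel_measurable_times_ennreal borel_measurable_indicator)
      also have "ennreal (r ^ DIM('a)) * (ennreal (r ^ k) * K) = K * ennreal (r ^ (DIM('a) + k))"
        using r by (simp add: power_add ennreal_mult mult_ac)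
      also have "r ^ (DIM('a) + k) = a powr p"
        using False r by (simp add: p_def r_def powr_half_sqrt[symmetric] powr_powr flip: powr_realpow)
      finally show ?thesis using False by simp
    qed
    finally show ?thesis .
  qed
  have \<nu>: "emeasure \<nu> {..a} = (if a \<le> 0 then 0 else K * ennreal (a powr p))" for a
  proof -
    have "emeasure \<nu> {..a} = (\<integral>\<^sup>+s. K * ennreal p * (ennreal (s powr (p - 1)) * indicator {0<..} s * indicator {..a} s) \<partial>lborel)"
      unfolding \<nu>_def by (subst emeasure_density) (auto simp: mult.assoc)
    \<comment> \<open>The end point \<open>0\<close> may be added because \<open>0 powr (p - 1) = 0\<close>, also for \<open>p = 1\<close>.\<close>
    also have "\<dots> = K * ennreal p * (\<integral>\<^sup>+s. ennreal (indicator {0..a} s * s powr (p - 1)) \<partial>lborel)"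
      by (subst nn_integral_cmult) (auto intro!: arg_cong2[of _ _ _ _ "(*)"] nn_integral_cong simp: indicator_def not_less le_less)
    also have "\<dots> = (if a \<le> 0 then 0 else K * ennreal (a powr p))"
    proof (cases "a < 0")
      case False
      have "(\<integral>\<^sup>+s. ennreal (indicator {0..a} s * s powr (p - 1)) \<partial>lborel) = ennreal (a powr p / p)"
        using nn_integral_has_integral_lebesgue[OF _ has_integral_powr_from_0[of "p - 1" a]] p False by simp
      then show ?thesis using p False
        by (auto simp: mult.assoc ennreal_mult[symmetric] simp flip: ennreal_mult')
    qed simp
    finally show ?thesis .
  qed
  have "\<mu> = \<nu>"
  proof (rule measure_eqI_generator_eq_countable)
    let ?E = "range (\<lambda>a::real. {..a})"
    show "Int_stable ?E" by (auto simp: Int_stable_def)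
    show "?E \<subseteq> Pow UNIV" "sets \<mu> = sigma_sets UNIV ?E" "sets \<nu> = sigma_sets UNIV ?E"
      by (auto simp: borel_eq_atMost)
    show "emeasure \<mu> X = emeasure \<nu> X" if "X \<in> ?E" for X
      using that by (auto simp: \<mu> \<nu>)
    show "(\<lambda>n. {..real n}) ` UNIV \<subseteq> ?E" "countable ((\<lambda>n. {..real n}) ` UNIV)" by auto
    show "\<Union> ((\<lambda>n. {..real n}) ` UNIV) = UNIV" using real_arch_simple by auto
    show "emeasure \<mu> X \<noteq> \<infinity>" if "X \<in> (\<lambda>n. {..real n}) ` UNIV" for X
      using that fin by (auto simp: \<mu> K_def[symmetric] ennreal_mult_eq_top_iff split: if_splits)
  qed
  have "(\<integral>\<^sup>+x. h x * \<phi> (x \<bullet> x) \<partial>lborel) = (\<integral>\<^sup>+s. \<phi> s \<partial>\<mu>)"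
    by (simp add: \<mu>_def nn_integral_distr nn_integral_density)
  also have "\<dots> = (\<integral>\<^sup>+s. K * ennreal p * (ennreal (s powr (p - 1)) * \<phi> s * indicator {0<..} s) \<partial>lborel)"
    unfolding \<open>\<mu> = \<nu>\<close> \<nu>_def by (simp add: nn_integral_density mult_ac)
  also have "\<dots> = K * ennreal p * (\<integral>\<^sup>+s\<in>{0<..}. ennreal (s powr (p - 1)) * \<phi> s \<partial>lborel)"
    by (rule nn_integral_cmult) measurable
  finally show ?thesis by (simp add: K_def)
qed

lemma trace_transpose_mul_self:
  fixes A :: "real ^ 'k::finite ^ 'm::finite"
  shows "trace (transpose A ** A) = A \<bullet> A"
  unfolding trace_def matrix_matrix_mult_def transpose_def inner_vec_def
  by simp (rule sum.swap)

text \<open>An admissible \<open>f\<close> is controlled only on the positive half-line. Cutting it off at \<open>0\<close> gives a Borel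
  function on all of \<open>real\<close>; the matrices on which this changes the density form a null set.\<close>

definition profile :: "(real \<Rightarrow> real) \<Rightarrow> real \<Rightarrow> ennreal" where
  "profile f s = ennreal (if 0 < s then f s else 0)"

lemma borel_measurable_profile:
  assumes "admissible N f" shows "profile f \<in> borel_measurable borel"
proof -
  have "(\<lambda>s. indicator {0<..} s *\<^sub>R f s) \<in> borel_measurable borel"
    using assms by (subst borel_measurable_restrict_space_iff[symmetric]) (auto simp: admissible_def)
  then have "(\<lambda>s. ennreal (indicator {0<..} s *\<^sub>R f s)) \<in> borel_measurable borel"
    by measurable
  also have "(\<lambda>s. ennreal (indicator {0<..} s *\<^sub>R f s)) = profile f"
    by (auto simp: profile_def indicator_def)
  finally show ?thesis .
qed

text \<open>The weight \<open>\<bar>det B\<bar>\<close> is homogeneous of degree \<open>m\<close> on a space of dimension \<open>m * (m + n)\<close>, and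
  \<open>m * (m + n) + m = N\<close>: the radial integral is the one prescribed by admissibility. Hence the normalization
  constant is finite, so that the Bochner integral defining it is genuine, and it is the same for
  every admissible \<open>f\<close>.\<close>

lemma ennreal_norm_const:
  assumes f: "admissible (CARD('m::finite) * (CARD('m) + CARD('n::finite) + 1)) f"
  defines "N \<equiv> CARD('m) * (CARD('m) + CARD('n) + 1)"
  defines "J \<equiv> (\<integral>\<^sup>+(A :: real ^ ('m + 'n) ^ 'm). ennreal \<bar>det (left_block A)\<bar> * profile f (A \<bullet> A) \<partial>lborel)"
  shows "ennreal (norm_const TYPE('m) TYPE('n) f) = J"
    and "J = (\<integral>\<^sup>+(A :: real ^ ('m + 'n) ^ 'm)\<in>cball 0 1. ennreal \<bar>det (left_block A)\<bar> \<partial>lborel)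
      * ennreal (real N / 2) * ennreal (2 / sphere_area N)"
proof -
  let ?D = "\<lambda>A :: real ^ ('m + 'n) ^ 'm. ennreal \<bar>det (left_block A)\<bar>"
  note [measurable] = borel_measurable_profile[OF f]
  have hom: "?D (r *\<^sub>R A) = ennreal (r ^ CARD('m)) * ?D A" if "r > 0" for r A
  proof -
    have "left_block (r *\<^sub>R A) = r *\<^sub>R mat 1 ** left_block A"
      by (simp add: left_block_def vec_eq_iff scalar_matrix_assoc flip: matrix_scalar_ac)
    moreover have "det (r *\<^sub>R mat 1 :: real ^ 'm ^ 'm) = r ^ CARD('m)"
      by (subst det_diagonal) (auto simp: mat_def)
    ultimately show ?thesis
      using that by (simp add: det_mul abs_mult ennreal_mult)
  qed
  have fin: "(\<integral>\<^sup>+A\<in>cball 0 1. ?D A \<partial>lborel) < \<infinity>"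
  proof -
    have "continuous_on (cball 0 1) (\<lambda>A :: real ^ ('m + 'n) ^ 'm. det (left_block A))"
      unfolding det_def left_block_def by (simp, intro continuous_intros)
    then have "bounded ((\<lambda>A :: real ^ ('m + 'n) ^ 'm. det (left_block A)) ` cball 0 1)"
      by (intro compact_imp_bounded compact_continuous_image) auto
    then obtain b where b: "\<forall>A\<in>cball 0 1. \<bar>det (left_block (A :: real ^ ('m + 'n) ^ 'm))\<bar> \<le> b"
      by (auto simp: bounded_iff)
    have "(\<integral>\<^sup>+A\<in>cball 0 1. ?D A \<partial>lborel) \<le> (\<integral>\<^sup>+A\<in>cball 0 1. ennreal b \<partial>(lborel :: (real ^ ('m + 'n) ^ 'm) measure))"
      using b by (intro nn_integral_mono) (auto simp: indicator_def intro!: ennreal_leI)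
    also have "\<dots> < \<infinity>"
      by (simp add: nn_integral_cmult_indicator emeasure_cball ennreal_mult[symmetric] ennreal_mult_less_top)
    finally show ?thesis .
  qed
  \<comment> \<open>\<open>N\<close> is the dimension of the matrix space plus the degree of the determinant.\<close>
  have N: "real (DIM(real ^ ('m + 'n) ^ 'm) + CARD('m)) / 2 = real N / 2"
    by (simp add: N_def algebra_simps)
  have admiss: "(\<integral>\<^sup>+s\<in>{0<..}. ennreal (s powr (real N / 2 - 1)) * profile f s \<partial>lborel) = ennreal (2 / sphere_area N)"
  proof -
    have "(\<integral>\<^sup>+s\<in>{0<..}. ennreal (s powr (real N / 2 - 1)) * profile f s \<partial>lborel)
       = (\<integral>\<^sup>+s\<in>{0<..}. ennreal (s powr (real N / 2 - 1) * f s) \<partial>lborel)"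
      using f by (intro nn_integral_cong) (auto simp: profile_def indicator_def admissible_def ennreal_mult)
    then show ?thesis using f by (simp add: admissible_def N_def)
  qed
  show J: "J = (\<integral>\<^sup>+A\<in>cball 0 1. ?D A \<partial>lborel) * ennreal (real N / 2) * ennreal (2 / sphere_area N)"
    unfolding J_def
    by (subst nn_integral_homogeneous_radial[where k = "CARD('m)"])
       (use hom fin in \<open>simp_all only: N admiss\<close>, measurable)
  have "J < \<infinity>"
    unfolding J using fin by (simp add: ennreal_mult_less_top)
  have eq: "ennreal \<bar>det (left_block A)\<bar> * profile f (A \<bullet> A)
      = ennreal (\<bar>det (left_block A)\<bar> * (if 0 < A \<bullet> A then f (A \<bullet> A) else 0))" for A :: "real ^ ('m + 'n) ^ 'm"
    using f by (auto simp: profile_def admissible_def ennreal_mult)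
  have "left_block (0 :: real ^ ('m + 'n) ^ 'm) = mat 0"
    by (simp add: left_block_def mat_def vec_eq_iff)
  then have zero: "det (left_block (0 :: real ^ ('m + 'n) ^ 'm)) = 0"
    by (simp only: det_0)
  \<comment> \<open>At \<open>A = 0\<close> the value of \<open>f\<close> is arbitrary, but the determinant vanishes since \<open>m \<ge> 1\<close>.\<close>
  have "\<bar>det (left_block A)\<bar> * f (trace (transpose A ** A))
      = enn2real (ennreal \<bar>det (left_block A)\<bar> * profile f (A \<bullet> A))" for A :: "real ^ ('m + 'n) ^ 'm"
    unfolding trace_transpose_mul_self eq using f by (cases "A = 0") (auto simp: zero admissible_def)
  then have "norm_const TYPE('m) TYPE('n) f = (LINT A|lborel. enn2real (?D A * profile f (A \<bullet> A)))"
    by (simp add: norm_const_def)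
  also have "\<dots> = enn2real (\<integral>\<^sup>+A. ennreal (enn2real (?D A * profile f (A \<bullet> A))) \<partial>lborel)"
    by (rule integral_eq_nn_integral) auto
  also have "(\<integral>\<^sup>+A. ennreal (enn2real (?D A * profile f (A \<bullet> A))) \<partial>lborel) = J"
    unfolding J_def by (intro nn_integral_cong ennreal_enn2real) (simp add: eq)
  finally show "ennreal (norm_const TYPE('m) TYPE('n) f) = J"
    using \<open>J < \<infinity>\<close> by simp
qed

section \<open>The law of the solution\<close>

text \<open>Cramer's rule, which is visibly measurable in the data. If the left block is singular, the
  division by \<open>0\<close> makes this the zero vector.\<close>

definition solution :: "real ^ 'n::finite \<Rightarrow> real ^ ('m::finite + 'n) ^ 'm \<Rightarrow> real ^ 'm \<Rightarrow> real ^ 'm" where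
  "solution u A b = (\<chi> k. det (\<chi> i j. if j = k then (b - right_block A *v u) $ i else left_block A $ i $ j)
     / det (left_block A))"

lemma solution_iff:
  assumes "det (left_block A) \<noteq> 0"
  shows "left_block A *v z = b - right_block A *v u \<longleftrightarrow> z = solution u A b"
  unfolding solution_def by (rule cramer[OF assms])

lemma borel_measurable_solution [measurable (raw)]:
  assumes [measurable]: "f \<in> borel_measurable M" "g \<in> borel_measurable M"
  shows "(\<lambda>x. solution u (f x) (g x)) \<in> borel_measurable M"
  unfolding solution_def by measurable

text \<open>On every line in the direction of the matrix \<open>(1, 0)\<close> only finitely many points have a singular left
  block.\<close>

lemma AE_det_left_block_nonzero:
  "AE A :: real ^ ('m::finite + 'n::finite) ^ 'm in lborel. det (left_block A) \<noteq> 0"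
proof -
  let ?Z = "{A :: real ^ ('m + 'n) ^ 'm. det (left_block A) = 0}"
  have "left_block (A + t *\<^sub>R join_blocks (mat 1, 0 :: real ^ 'n ^ 'm)) = left_block A + t *\<^sub>R mat 1"
    for A :: "real ^ ('m + 'n) ^ 'm" and t
    by (simp add: left_block_def join_blocks_def vec_eq_iff)
  then have "?Z \<in> null_sets lborel"
    by (intro null_set_of_countable_lines[where v = "join_blocks (mat 1, 0)"])
       (auto intro!: countable_finite finite_det_line_zeros)
  then show ?thesis
    by (rule AE_not_in[THEN eventually_mono]) auto
qed

text \<open>For fixed \<open>A\<close> with invertible left block, the substitution \<open>b = B z + X u\<close> replaces the integral over
  \<open>b\<close> by one over the solution \<open>z\<close> and brings in the Jacobian \<open>\<bar>det B\<bar>\<close>. Exchanging the integrals over \<open>A\<close> and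
  \<open>z\<close> leaves the integral over \<open>A\<close> computed in \<open>nn_integral_universal_density\<close>.\<close>

lemma nn_integral_solution:
  fixes \<phi> :: "real \<Rightarrow> ennreal" and g :: "real ^ 'm::finite \<Rightarrow> ennreal" and u :: "real ^ 'n::finite"
  assumes [measurable]: "\<phi> \<in> borel_measurable borel" "g \<in> borel_measurable borel"
  defines "\<beta> \<equiv> sqrt (1 + u \<bullet> u)"
  shows "(\<integral>\<^sup>+A. \<integral>\<^sup>+b. \<phi> (A \<bullet> A + b \<bullet> b) * g (solution u A b) \<partial>lborel \<partial>lborel)
    = (\<integral>\<^sup>+(A :: real ^ ('m + 'n) ^ 'm). ennreal \<bar>det (left_block A)\<bar> * \<phi> (A \<bullet> A) \<partial>lborel) *
      (\<integral>\<^sup>+z. ennreal (\<beta> / (\<beta>\<^sup>2 + z \<bullet> z) powr ((real CARD('m) + 1) / 2)) * g z \<partial>lborel)"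
proof -
  let ?J = "\<integral>\<^sup>+(A :: real ^ ('m + 'n) ^ 'm). ennreal \<bar>det (left_block A)\<bar> * \<phi> (A \<bullet> A) \<partial>lborel"
  let ?p = "\<lambda>z :: real ^ 'm. ennreal (\<beta> / (\<beta>\<^sup>2 + z \<bullet> z) powr ((real CARD('m) + 1) / 2))"
  let ?F = "\<lambda>(A :: real ^ ('m + 'n) ^ 'm) z. ennreal \<bar>det (left_block A)\<bar> *
      \<phi> (A \<bullet> A + (left_block A *v z + right_block A *v u) \<bullet> (left_block A *v z + right_block A *v u))"
  have "(\<integral>\<^sup>+b. \<phi> (A \<bullet> A + b \<bullet> b) * g (solution u A b) \<partial>lborel) = (\<integral>\<^sup>+z. ?F A z * g z \<partial>lborel)"
    if d: "det (left_block A) \<noteq> 0" for A :: "real ^ ('m + 'n) ^ 'm"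
  proof -
    let ?r = "right_block A *v u"
    have sol: "solution u A (?r + left_block A *v z) = z" for z
      by (rule solution_iff[OF d, THEN iffD1, symmetric]) simp
    have "(\<integral>\<^sup>+b. \<phi> (A \<bullet> A + b \<bullet> b) * g (solution u A b) \<partial>lborel)
        = (\<integral>\<^sup>+b. \<phi> (A \<bullet> A + (?r + b) \<bullet> (?r + b)) * g (solution u A (?r + b)) \<partial>lborel)"
      by (rule nn_integral_lborel_translate[symmetric]) measurable
    also have "\<dots> = ennreal \<bar>det (left_block A)\<bar> * (\<integral>\<^sup>+z. \<phi> (A \<bullet> A + (?r + left_block A *v z) \<bullet> (?r + left_block A *v z))
        * g (solution u A (?r + left_block A *v z)) \<partial>lborel)"
      by (rule nn_integral_matrix_vector_mult[OF d]) measurable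
    also have "\<dots> = (\<integral>\<^sup>+z. ?F A z * g z \<partial>lborel)"
      unfolding sol by (subst nn_integral_cmult[symmetric]) (simp_all add: mult.assoc add.commute)
    finally show ?thesis .
  qed
  with AE_det_left_block_nonzero
  have "AE A :: real ^ ('m + 'n) ^ 'm in lborel. (\<integral>\<^sup>+b. \<phi> (A \<bullet> A + b \<bullet> b) * g (solution u A b) \<partial>lborel)
      = (\<integral>\<^sup>+z. ?F A z * g z \<partial>lborel)"
    by (rule eventually_mono)
  then have "(\<integral>\<^sup>+A. \<integral>\<^sup>+b. \<phi> (A \<bullet> A + b \<bullet> b) * g (solution u A b) \<partial>lborel \<partial>lborel)
     = (\<integral>\<^sup>+A. \<integral>\<^sup>+z. ?F A z * g z \<partial>lborel \<partial>lborel)"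
    by (rule nn_integral_cong_AE)
  also have "\<dots> = (\<integral>\<^sup>+z. \<integral>\<^sup>+A. ?F A z * g z \<partial>lborel \<partial>lborel)"
    by (rule lborel_pair.Fubini') measurable
  also have "\<dots> = (\<integral>\<^sup>+z. ?J * (?p z * g z) \<partial>lborel)"
  proof (rule nn_integral_cong)
    fix z :: "real ^ 'm"
    have "(\<integral>\<^sup>+A. ?F A z * g z \<partial>lborel) = (\<integral>\<^sup>+A. ?F A z \<partial>lborel) * g z"
      by (rule nn_integral_multc) measurable
    also have "(\<integral>\<^sup>+A. ?F A z \<partial>lborel) = ?p z * ?J"
      unfolding \<beta>_def by (rule nn_integral_universal_density) measurable
    finally show "(\<integral>\<^sup>+A. ?F A z * g z \<partial>lborel) = ?J * (?p z * g z)"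
      by (simp only: mult_ac)
  qed
  also have "\<dots> = ?J * (\<integral>\<^sup>+z. ?p z * g z \<partial>lborel)"
    by (rule nn_integral_cmult) measurable
  finally show ?thesis .
qed

theorem theorem4p2:
  fixes M :: "'w measure"
    and A :: "'w \<Rightarrow> real ^ ('m::finite + 'n::finite) ^ 'm"
    and b :: "'w \<Rightarrow> real ^ 'm"
    and f :: "real \<Rightarrow> real"
    and u :: "real ^ 'n"
  assumes "prob_space M"
    and "admissible (CARD('m) * (CARD('m) + CARD('n) + 1)) f"
    and "distributed M lborel (\<lambda>\<omega>. (A \<omega>, b \<omega>))
           (\<lambda>(A, b). ennreal (f (trace (transpose A ** A) + b \<bullet> b)))"
  shows "let \<beta> = sqrt (1 + u \<bullet> u);
             C = norm_const TYPE('m) TYPE('n) f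
         in (AE \<omega> in M. \<exists>!z. left_block (A \<omega>) *v z = b \<omega> - right_block (A \<omega>) *v u) \<and>
            (\<forall>z \<in> borel_measurable M.
               (AE \<omega> in M. left_block (A \<omega>) *v z \<omega> = b \<omega> - right_block (A \<omega>) *v u) \<longrightarrow>
               distributed M lborel z
                 (\<lambda>z. ennreal (C * (\<beta> / (\<beta>\<^sup>2 + z \<bullet> z) powr ((real CARD('m) + 1) / 2))))) \<and>
            (\<forall>g. admissible (CARD('m) * (CARD('m) + CARD('n) + 1)) g \<longrightarrow>
               norm_const TYPE('m) TYPE('n) g = C)"
proof -
  let ?N = "CARD('m) * (CARD('m) + CARD('n) + 1)"
  define \<beta> where "\<beta> = sqrt (1 + u \<bullet> u)"
  define C where "C = norm_const TYPE('m) TYPE('n) f"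
  define p where "p z = \<beta> / (\<beta>\<^sup>2 + z \<bullet> z) powr ((real CARD('m) + 1) / 2)" for z :: "real ^ 'm"
  interpret prob_space M by fact
  note [measurable] = borel_measurable_profile[OF assms(2)]
  have norm_const_nonneg: "norm_const TYPE('m) TYPE('n) g \<ge> 0" if "admissible ?N g" for g
  proof -
    have "\<bar>det (left_block A)\<bar> * g (trace (transpose A ** A)) \<ge> 0" for A :: "real ^ ('m + 'n) ^ 'm"
      using that by (cases "A = 0")
        (auto simp: trace_transpose_mul_self admissible_def left_block_def det_zero_row row_def vec_eq_iff)
    then show ?thesis unfolding norm_const_def by (intro Bochner_Integration.integral_nonneg)
  qed
  let ?given = "\<lambda>(A :: real ^ ('m + 'n) ^ 'm, b :: real ^ 'm). ennreal (f (trace (transpose A ** A) + b \<bullet> b))"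
  let ?G = "\<lambda>P :: (real ^ ('m + 'n) ^ 'm) \<times> (real ^ 'm). profile f (fst P \<bullet> fst P + snd P \<bullet> snd P)"
  have [measurable]: "fst \<in> borel_measurable (borel :: ((real ^ ('m + 'n) ^ 'm) \<times> (real ^ 'm)) measure)"
      "snd \<in> borel_measurable (borel :: ((real ^ ('m + 'n) ^ 'm) \<times> (real ^ 'm)) measure)"
    by (intro borel_measurable_continuous_onI continuous_intros)+
  have [measurable]: "?G \<in> borel_measurable borel"
    by (intro measurable_compose[OF _ borel_measurable_profile[OF assms(2)]] borel_measurable_continuous_onI continuous_intros)
  have dist: "distributed M lborel (\<lambda>\<omega>. (A \<omega>, b \<omega>)) ?G"
  proof (rule distributed_cong_density[THEN iffD1, OF _ _ _ assms(3)])
    have "AE P in lborel. P \<noteq> (0 :: (real ^ ('m + 'n) ^ 'm) \<times> (real ^ 'm))" by (rule AE_lborel_singleton)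
    then show "AE P in lborel. ?given P = ?G P"
    proof eventually_elim
      case (elim P)
      then have "fst P \<bullet> fst P + snd P \<bullet> snd P > 0"
        by (cases P) (auto simp: zero_prod_def add_pos_nonneg add_nonneg_pos)
      then show ?case
        by (cases P) (simp add: trace_transpose_mul_self profile_def)
    qed
    show "?given \<in> borel_measurable lborel"
      using assms(3) by (rule distributed_borel_measurable)
    show "?G \<in> borel_measurable lborel" by simp
  qed
  have [measurable]: "(\<lambda>\<omega>. (A \<omega>, b \<omega>)) \<in> borel_measurable M"
    using distributed_measurable[OF dist] by simp
  have nonsingular: "AE \<omega> in M. det (left_block (A \<omega>)) \<noteq> 0"
  proof -
    have "AE P in lborel \<Otimes>\<^sub>M (lborel :: (real ^ 'm) measure). det (left_block (fst P :: real ^ ('m + 'n) ^ 'm)) \<noteq> 0"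
    proof (rule lborel_pair.AE_pair_measure)
      show "{P \<in> space (lborel \<Otimes>\<^sub>M (lborel :: (real ^ 'm) measure)). det (left_block (fst P :: real ^ ('m + 'n) ^ 'm)) \<noteq> 0}
          \<in> sets (lborel \<Otimes>\<^sub>M lborel)" by measurable
      show "AE A in lborel. AE b in (lborel :: (real ^ 'm) measure). det (left_block (fst (A :: real ^ ('m + 'n) ^ 'm, b))) \<noteq> 0"
        using AE_det_left_block_nonzero by (rule eventually_mono) simp
    qed
    then have "AE P in (lborel :: ((real ^ ('m + 'n) ^ 'm) \<times> (real ^ 'm)) measure). det (left_block (fst P)) \<noteq> 0"
      by (simp only: lborel_prod)
    then have "AE P in distr M lborel (\<lambda>\<omega>. (A \<omega>, b \<omega>)). det (left_block (fst P)) \<noteq> 0"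
      unfolding distributed_distr_eq_density[OF dist]
      by (subst AE_density) (auto elim: eventually_mono)
    from AE_distrD[OF distributed_measurable[OF dist] this] show ?thesis
      by simp
  qed
  have unique: "AE \<omega> in M. \<exists>!z. left_block (A \<omega>) *v z = b \<omega> - right_block (A \<omega>) *v u"
    using nonsingular by eventually_elim (simp add: solution_iff)
  have law: "distributed M lborel z (\<lambda>z. ennreal (C * p z))"
    if [measurable]: "z \<in> borel_measurable M"
      and z: "AE \<omega> in M. left_block (A \<omega>) *v z \<omega> = b \<omega> - right_block (A \<omega>) *v u" for z
  proof -
    have [measurable]: "p \<in> borel_measurable borel" unfolding p_def by measurable
    have sol: "AE \<omega> in M. z \<omega> = solution u (A \<omega>) (b \<omega>)"
      using z nonsingular by eventually_elim (simp add: solution_iff)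
    have "distr M lborel z = density lborel (\<lambda>z. ennreal (C * p z))"
    proof (rule measure_eqI)
      fix E assume "E \<in> sets (distr M lborel z)"
      then have [measurable]: "E \<in> sets borel" by simp
      have "emeasure (distr M lborel z) E = (\<integral>\<^sup>+y. indicator E y \<partial>distr M lborel z)"
        by simp
      also have "\<dots> = (\<integral>\<^sup>+\<omega>. indicator E (z \<omega>) \<partial>M)"
        by (rule nn_integral_distr) measurable
      also have "\<dots> = (\<integral>\<^sup>+\<omega>. indicator E (solution u (A \<omega>) (b \<omega>)) \<partial>M)"
        using sol by (intro nn_integral_cong_AE) auto
      also have "\<dots> = (\<integral>\<^sup>+P. ?G P * indicator E (solution u (fst P) (snd P)) \<partial>lborel)"
        using distributed_nn_integral[OF dist, of "\<lambda>P. indicator E (solution u (fst P) (snd P))"] by simp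
      also have "\<dots> = (\<integral>\<^sup>+A. \<integral>\<^sup>+b. profile f (A \<bullet> A + b \<bullet> b) * indicator E (solution u A b) \<partial>lborel \<partial>lborel)"
        by (subst lborel_prod[symmetric], subst lborel.nn_integral_fst[symmetric]) (simp_all add: lborel_prod)
      also have "\<dots> = ennreal C * (\<integral>\<^sup>+z. ennreal (p z) * indicator E z \<partial>lborel)"
        unfolding C_def p_def \<beta>_def ennreal_norm_const(1)[OF assms(2)]
        by (rule nn_integral_solution) measurable
      also have "\<dots> = (\<integral>\<^sup>+z. ennreal (C * p z) * indicator E z \<partial>lborel)"
        using norm_const_nonneg[OF assms(2)]
        by (subst nn_integral_cmult[symmetric]) (auto simp: C_def ennreal_mult' mult.assoc)
      also have "\<dots> = emeasure (density lborel (\<lambda>z. ennreal (C * p z))) E"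
        by (simp add: emeasure_density)
      finally show "emeasure (distr M lborel z) E = emeasure (density lborel (\<lambda>z. ennreal (C * p z))) E" .
    qed simp
    then show ?thesis by (simp add: distributed_def)
  qed
  have universal: "norm_const TYPE('m) TYPE('n) g = C" if "admissible ?N g" for g
  proof -
    have "ennreal (norm_const TYPE('m) TYPE('n) g) = ennreal C"
      using ennreal_norm_const[OF that] ennreal_norm_const[OF assms(2)] by (simp add: C_def)
    then show ?thesis
      using norm_const_nonneg that assms(2) by (simp add: C_def)
  qed
  show ?thesis
    using unique law universal by (simp add: Let_def C_def p_def \<beta>_def)
qed

end
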